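(* Let $N$ be a planar bipartite graph of type $(k,n)$ and let $I,J\in\binom{[n]}{k}$. Then $$\Delta_I(N)\,\Delta_J(N) = \sum_{(\tau,T)} F_{\tau,T}(N),$$ where the sum is over all $(k,n)$-partial non-crossing pairings $(\tau,T)$ compatible with $(I,J)$.
   Context: Planar bipartite graph $N$ of type $(k,n)$: a finite graph embedded in a closed disk, with $n$ boundary vertices on the boundary labeled $1,\dots,n$ clockwise, all other (interior) vertices inside; vertices colored black/white, each edge joins a black and a white vertex; each boundary vertex has degree one, no edge joins two boundary vertices; edges carry real weights. A boundary vertex is black (resp. white) if adjacent to a white (resp. black) interior vertex. $k := \#\{\text{white boundary vertices}\} + \#\{\text{interior white}\} - \#\{\text{interior black}\}$. A dimer configuration $\Pi$ is a set of edges using each interior vertex exactly once; $I(\Pi)$ = (black boundary vertices used) $\cup$ (white boundary vertices unused); $\Delta_I(N)=\sum_{I(\Pi)=I}\prod_{e\in\Pi}e$. A $(k,n)$-partial non-crossing pairing is a pair $(\tau,T)$ where $\tau$ is a perfect matching of an even subset $S=S(\tau)\subseteq[n]$ whose pairs, drawn as chords of a disk with $1,\dots,n$ on the boundary circle, do not cross, and $T\subseteq [n]\setminus S$ with $|S|+2|T|=2k$. A Temperley–Lieb subgraph $\Sigma$ of $N$ is a set of edges covering every interior vertex such that each connected component is either a path joining two boundary vertices (interior vertices of degree 2), a simple cycle through interior vertices only, or a single edge. The paths of $\Sigma$ define a non-crossing pairing $\tau(\Sigma)$, and $T(\Sigma)$ is the set of black boundary vertices lying in single-edge components together with white boundary vertices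 not lying in $\Sigma$. Its weight $\mathrm{wt}(\Sigma)$ is $2^{\#\text{cycles}}$ times the product of the weights of edges on paths and cycles times the squares of the weights of single-edge components. The Temperley–Lieb immanant is $F_{\tau,T}(N) := \sum_{\Sigma:\ \tau(\Sigma)=\tau,\ T(\Sigma)=T} \mathrm{wt}(\Sigma)$. A pairing $(\tau,T)$ is compatible with $(I,J)$ if $S(\tau)=(I\setminus J)\cup(J\setminus I)$, each pair of $\tau$ joins an element of $I\setminus J$ with an element of $J\setminus I$, and $T=I\cap J$. *)

theory Defs
  imports "HOL-Analysis.Analysis"
begin

text \<open>A planar bipartite graph in a disk, given together with a topological
embedding into the closed unit disk of the complex plane.
Boundary vertices are bdv 1, ..., bdv n; interior vertices form intv.
Every edge e has a black end bend e and a white end wend e.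
Colours blk (True = black) are given on all vertices; for a boundary vertex
the colour is forced to be opposite to that of its unique neighbour,
in accordance with the paper's convention.\<close>

record ('v, 'e) pbgraph =
  nb   :: nat
  intv :: "'v set"
  bdv  :: "nat \<Rightarrow> 'v"
  blk  :: "'v \<Rightarrow> bool"
  edg  :: "'e set"
  bend :: "'e \<Rightarrow> 'v"
  wend :: "'e \<Rightarrow> 'v"
  wgt  :: "'e \<Rightarrow> real"
  pos  :: "'v \<Rightarrow> complex"
  crv  :: "'e \<Rightarrow> real \<Rightarrow> complex"

definition bverts :: "('v, 'e, 'z) pbgraph_scheme \<Rightarrow> 'v set" where
  "bverts N = bdv N ` {1..nb N}"

definition ends :: "('v, 'e, 'z) pbgraph_scheme \<Rightarrow> 'e \<Rightarrow> 'v set" where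
  "ends N e = {bend N e, wend N e}"

definition incid :: "('v, 'e, 'z) pbgraph_scheme \<Rightarrow> 'e set \<Rightarrow> 'v \<Rightarrow> 'e set" where
  "incid N F x = {e \<in> F. x \<in> ends N e}"

definition deg :: "('v, 'e, 'z) pbgraph_scheme \<Rightarrow> 'e set \<Rightarrow> 'v \<Rightarrow> nat" where
  "deg N F x = card (incid N F x)"

definition is_pbgraph :: "('v, 'e, 'z) pbgraph_scheme \<Rightarrow> bool" where
  "is_pbgraph N \<longleftrightarrow>
     finite (intv N) \<and> finite (edg N) \<and>
     inj_on (bdv N) {1..nb N} \<and> intv N \<inter> bverts N = {} \<and>
     (\<forall>e\<in>edg N. bend N e \<in> intv N \<union> bverts N \<and> wend N e \<in> intv N \<union> bverts N \<and>
                 blk N (bend N e) \<and> \<not> blk N (wend N e) \<and>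
                 (bend N e \<in> intv N \<or> wend N e \<in> intv N)) \<and>
     (\<forall>i\<in>{1..nb N}. deg N (edg N) (bdv N i) = 1)"

definition disk_embedded :: "('v, 'e, 'z) pbgraph_scheme \<Rightarrow> bool" where
  "disk_embedded N \<longleftrightarrow>
     inj_on (pos N) (intv N \<union> bverts N) \<and>
     (\<forall>v\<in>intv N. pos N v \<in> ball 0 1) \<and>
     (\<exists>t :: nat \<Rightarrow> real. strict_mono_on {1..nb N} t \<and>
        (\<forall>i\<in>{1..nb N}. 0 \<le> t i \<and> t i < 2 * pi \<and> pos N (bdv N i) = cis (- t i))) \<and>
     (\<forall>e\<in>edg N. arc (crv N e) \<and> pathstart (crv N e) = pos N (bend N e) \<and>
                 pathfinish (crv N e) = pos N (wend N e) \<and>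
                 path_image (crv N e) \<subseteq> cball 0 1) \<and>
     (\<forall>e\<in>edg N. \<forall>f\<in>edg N. e \<noteq> f \<longrightarrow>
        path_image (crv N e) \<inter> path_image (crv N f) \<subseteq> pos N ` (ends N e \<inter> ends N f)) \<and>
     (\<forall>e\<in>edg N. \<forall>v\<in>intv N \<union> bverts N.
        pos N v \<in> path_image (crv N e) \<longrightarrow> v \<in> ends N e)"

definition pbg_type :: "('v, 'e, 'z) pbgraph_scheme \<Rightarrow> nat \<Rightarrow> nat \<Rightarrow> bool" where
  "pbg_type N k n \<longleftrightarrow> is_pbgraph N \<and> disk_embedded N \<and> nb N = n \<and>
     int k = int (card {i\<in>{1..n}. \<not> blk N (bdv N i)})
             + int (card {v\<in>intv N. \<not> blk N v}) - int (card {v\<in>intv N. blk N v})"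

definition is_dimer :: "('v, 'e, 'z) pbgraph_scheme \<Rightarrow> 'e set \<Rightarrow> bool" where
  "is_dimer N P \<longleftrightarrow> P \<subseteq> edg N \<and> (\<forall>v\<in>intv N. deg N P v = 1)"

definition Ilab :: "('v, 'e, 'z) pbgraph_scheme \<Rightarrow> 'e set \<Rightarrow> nat set" where
  "Ilab N P = {i\<in>{1..nb N}. blk N (bdv N i) \<and> incid N P (bdv N i) \<noteq> {}}
            \<union> {i\<in>{1..nb N}. \<not> blk N (bdv N i) \<and> incid N P (bdv N i) = {}}"

definition Delta :: "('v, 'e, 'z) pbgraph_scheme \<Rightarrow> nat set \<Rightarrow> real" where
  "Delta N I = (\<Sum>P\<in>{P. is_dimer N P \<and> Ilab N P = I}. \<Prod>e\<in>P. wgt N e)"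

definition eadj :: "('v, 'e, 'z) pbgraph_scheme \<Rightarrow> 'e set \<Rightarrow> ('e \<times> 'e) set" where
  "eadj N S = {(e, f). e \<in> S \<and> f \<in> S \<and> ends N e \<inter> ends N f \<noteq> {}}"

definition comps :: "('v, 'e, 'z) pbgraph_scheme \<Rightarrow> 'e set \<Rightarrow> 'e set set" where
  "comps N S = (\<lambda>e. {f. (e, f) \<in> (eadj N S)\<^sup>*}) ` S"

definition cverts :: "('v, 'e, 'z) pbgraph_scheme \<Rightarrow> 'e set \<Rightarrow> 'v set" where
  "cverts N C = (\<Union>e\<in>C. ends N e)"

definition is_bpath :: "('v, 'e, 'z) pbgraph_scheme \<Rightarrow> 'e set \<Rightarrow> 'e set \<Rightarrow> bool" where
  "is_bpath N S C \<longleftrightarrow> card (cverts N C \<inter> bverts N) = 2 \<and>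
     (\<forall>x\<in>cverts N C. if x \<in> bverts N then deg N S x = 1 else deg N S x = 2)"

definition is_icycle :: "('v, 'e, 'z) pbgraph_scheme \<Rightarrow> 'e set \<Rightarrow> 'e set \<Rightarrow> bool" where
  "is_icycle N S C \<longleftrightarrow> (\<forall>x\<in>cverts N C. x \<in> intv N \<and> deg N S x = 2)"

definition is_TL :: "('v, 'e, 'z) pbgraph_scheme \<Rightarrow> 'e set \<Rightarrow> bool" where
  "is_TL N S \<longleftrightarrow> S \<subseteq> edg N \<and> (\<forall>v\<in>intv N. incid N S v \<noteq> {}) \<and>
     (\<forall>C\<in>comps N S. card C = 1 \<or> is_bpath N S C \<or> is_icycle N S C)"

definition tau_of :: "('v, 'e, 'z) pbgraph_scheme \<Rightarrow> 'e set \<Rightarrow> nat set set" where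
  "tau_of N S = {{i, j} | i j. i \<in> {1..nb N} \<and> j \<in> {1..nb N} \<and> i \<noteq> j \<and>
     (\<exists>C\<in>comps N S. is_bpath N S C \<and> bdv N i \<in> cverts N C \<and> bdv N j \<in> cverts N C)}"

definition T_of :: "('v, 'e, 'z) pbgraph_scheme \<Rightarrow> 'e set \<Rightarrow> nat set" where
  "T_of N S = {i\<in>{1..nb N}. blk N (bdv N i) \<and>
                  (\<exists>C\<in>comps N S. card C = 1 \<and> bdv N i \<in> cverts N C)}
            \<union> {i\<in>{1..nb N}. \<not> blk N (bdv N i) \<and> incid N S (bdv N i) = {}}"

definition wtTL :: "('v, 'e, 'z) pbgraph_scheme \<Rightarrow> 'e set \<Rightarrow> real" where
  "wtTL N S = 2 ^ card {C\<in>comps N S. is_icycle N S C} *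
     (\<Prod>C\<in>comps N S. if card C = 1 then (\<Prod>e\<in>C. (wgt N e)\<^sup>2) else (\<Prod>e\<in>C. wgt N e))"

definition TLimm :: "('v, 'e, 'z) pbgraph_scheme \<Rightarrow> nat set set \<Rightarrow> nat set \<Rightarrow> real" where
  "TLimm N tau T = (\<Sum>S\<in>{S. is_TL N S \<and> tau_of N S = tau \<and> T_of N S = T}. wtTL N S)"

definition ncpairing :: "nat \<Rightarrow> nat \<Rightarrow> nat set set \<Rightarrow> nat set \<Rightarrow> bool" where
  "ncpairing k n tau T \<longleftrightarrow>
     (\<forall>p\<in>tau. \<exists>a b. p = {a, b} \<and> a \<noteq> b \<and> a \<in> {1..n} \<and> b \<in> {1..n}) \<and>
     (\<forall>p\<in>tau. \<forall>q\<in>tau. p \<noteq> q \<longrightarrow> p \<inter> q = {}) \<and>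
     (\<forall>a b c d. {a, b} \<in> tau \<and> {c, d} \<in> tau \<longrightarrow> \<not> (a < c \<and> c < b \<and> b < d)) \<and>
     T \<subseteq> {1..n} - \<Union>tau \<and>
     card (\<Union>tau) + 2 * card T = 2 * k"

definition compatible :: "nat set \<Rightarrow> nat set \<Rightarrow> nat set set \<Rightarrow> nat set \<Rightarrow> bool" where
  "compatible I J tau T \<longleftrightarrow>
     \<Union>tau = (I - J) \<union> (J - I) \<and>
     (\<forall>p\<in>tau. \<exists>a\<in>I - J. \<exists>b\<in>J - I. p = {a, b}) \<and>
     T = I \<inter> J"

end

theory Submission
  imports Defs
begin

text \<open>Superimposing two dimer configurations gives a Temperley--Lieb subgraph \<open>S = P \<union>
Q\<close>: the common edges are its single-edge components, and along every path and cycle the edges lie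
alternately in \<open>P\<close> and \<open>Q\<close>. Conversely, a pair of dimer configurations with union
\<open>S\<close> is a choice of one of the two alternating colourings on each path and cycle of
\<open>S\<close>. The end points of a path have different labels, because a signed count over the vertices of
the path cancels except at its ends; hence prescribing \<open>(I, J)\<close> compatible with \<open>S\<close>
fixes the colouring on the paths and leaves a factor \<open>2\<close> for each cycle. The pairing is
non-crossing by the Fashoda meet theorem, transported to the disk by a Moebius map.\<close>

subsection \<open>Crossing paths in a disk\<close>

text \<open>Components are defined by reachability, so no path or cycle comes with an enumeration of
  its edges. Shapes are therefore recovered from degrees by counting, and properties spread over a
  component by induction along shared vertices. An alternating colouring, obvious once a path or
  cycle is traversed, comes instead from two involutions: one exchanges the two edges at a black
  vertex, the other those at a white vertex, and bipartiteness makes every adjacency one of these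
  exchanges. The parity of words in the involutions gives the colours.

  The index set on the right-hand side imposes non-crossing and a cardinality condition, neither of
  which is visible in a pair of dimer configurations. Both hold for every Temperley--Lieb subgraph
  \<open>S\<close> compatible with \<open>(I, J)\<close>, so grouping by
  \<open>(tau_of N S, T_of N S)\<close> loses no term; this is where the embedding enters.\<close>

lemma cis_inj_2pi:
  assumes "cis x = cis y" "0 \<le> x" "x < 2 * pi" "0 \<le> y" "y < 2 * pi"
  shows "x = y"
proof -
  have "cis (x - y) = 1"
    using assms(1) by (simp flip: cis_divide)
  then have "cos (x - y) = 1"
    by (simp add: complex_eq_iff)
  then obtain n :: int where n: "x - y = of_int n * 2 * pi"
    by (auto simp: cos_one_2pi_int)
  have "of_int n * (2 * pi) < 1 * (2 * pi)" "(- 1) * (2 * pi) < of_int n * (2 * pi)"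
    using assms n by (simp_all only: flip: mult.assoc)
  then have "real_of_int n < 1" "- 1 < real_of_int n"
    by (simp_all only: mult_less_cancel_right_pos pi_gt_zero zero_less_mult_iff zero_less_numeral simp_thms)
  then have "n = 0"
    by linarith
  with n show ?thesis
    by simp
qed

text \<open>This is the Fashoda theorem for four interlaced end points on one side of a rectangle,
  with the real axis as that side; \<open>h\<close> identifies the complex plane with
  \<open>real^2\<close>.\<close>

lemma half_plane_paths_meet:
  assumes "path f" "path g"
    and up: "\<And>z. z \<in> path_image f \<union> path_image g \<Longrightarrow> 0 \<le> Im z"
    and real: "Im (pathstart f) = 0" "Im (pathfinish f) = 0"
      "Im (pathstart g) = 0" "Im (pathfinish g) = 0"
    and order: "Re (pathstart f) < Re (pathstart g)" "Re (pathstart g) < Re (pathfinish f)"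
      "Re (pathfinish f) < Re (pathfinish g)"
  shows "path_image f \<inter> path_image g \<noteq> {}"
proof -
  define h :: "complex \<Rightarrow> real^2" where "h z = (\<chi> i. if i = 1 then Re z else Im z)" for z
  have h1: "h z $ 1 = Re z" and h2: "h z $ 2 = Im z" for z
    by (simp_all add: h_def)
  have injh: "z = z'" if "h z = h z'" for z z'
    using that h1 h2 by (metis complex_eqI)
  have conth: "continuous_on X h" for X
    unfolding h_def
  proof (rule continuous_on_vec_lambda)
    show "continuous_on X (\<lambda>z. if i = 1 then Re z else Im z)" for i :: 2
      by (cases "i = 1") (auto intro!: continuous_intros)
  qed
  obtain M where M: "M > 0" "path_image f \<union> path_image g \<subseteq> ball 0 M"
    using bounded_subset_ballD[of "path_image f \<union> path_image g" 0] assms(1,2)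
    by (auto simp: bounded_path_image)
  \<comment> \<open>The bottom side of the box lies on the real axis, and \<open>M\<close> bounds
    the moduli on both images.\<close>
  define a b :: "real^2" where "a = vector [-M, 0]" and "b = vector [M, M]"
  have box: "h z \<in> cbox a b" if "z \<in> path_image f \<union> path_image g" for z
  proof -
    have "norm z < M" "0 \<le> Im z"
      using that M up by auto
    then show ?thesis
      using abs_Re_le_cmod[of z] abs_Im_le_cmod[of z]
      unfolding mem_box_cart forall_2 h1 h2 by (simp add: a_def b_def abs_le_iff)
  qed
  obtain z where "z \<in> path_image (h \<circ> f)" "z \<in> path_image (h \<circ> g)"
  proof (rule fashoda_interlace[of "h \<circ> f" "h \<circ> g" a b])
    show "path (h \<circ> f)" "path (h \<circ> g)"
      using assms(1,2) conth by (simp_all add: path_continuous_image)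
    show "path_image (h \<circ> f) \<subseteq> cbox a b" "path_image (h \<circ> g) \<subseteq> cbox a b"
      using box by (auto simp: path_image_compose)
  qed (use real order in \<open>auto simp: pathstart_compose pathfinish_compose h1 h2 a_def\<close>)
  then show ?thesis
    using injh by (auto simp: path_image_compose)
qed

text \<open>\<open>\<phi>\<close> is the Cayley transform with pole \<open>1\<close>. It maps the
  closed disk without its pole into the closed upper half plane and sends \<open>cis t\<close> to
  \<open>- cot (t / 2)\<close>, which increases on the open interval from \<open>0\<close> to
  \<open>2 * pi\<close>; interlacing on the circle thus becomes interlacing on the real
  axis.\<close>

lemma disk_paths_meet_aux:
  assumes pc: "path_component A (cis \<alpha>) (cis \<gamma>)" "path_component B (cis \<beta>) (cis \<delta>)"
    and A: "A \<subseteq> cball 0 1 - {1}" and B: "B \<subseteq> cball 0 1 - {1}"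
    and order: "0 < \<alpha>" "\<alpha> < \<beta>" "\<beta> < \<gamma>" "\<gamma> < \<delta>" "\<delta> < 2 * pi"
  shows "A \<inter> B \<noteq> {}"
proof -
  define \<phi> where "\<phi> z = - \<i> * (1 + z) / (z - 1)" for z :: complex
  have inj: "z = z'" if "\<phi> z = \<phi> z'" "z \<noteq> 1" "z' \<noteq> 1" for z z'
    using that unfolding \<phi>_def by (simp add: field_simps)
  have im: "Im (\<phi> z) = (1 - (cmod z)\<^sup>2) / (cmod (1 - z))\<^sup>2" for z
  proof -
    have "(Re (1 - z))\<^sup>2 + (Im (1 - z))\<^sup>2 = (Re (z - 1))\<^sup>2 + (Im (z - 1))\<^sup>2"
      by (simp add: power2_eq_square algebra_simps)
    moreover have "Im (- \<i> * (1 + z)) * Re (z - 1) - Re (- \<i> * (1 + z)) * Im (z - 1) = 1 - ((Re z)\<^sup>2 + (Im z)\<^sup>2)"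
      by (simp add: power2_eq_square algebra_simps)
    ultimately show ?thesis
      unfolding \<phi>_def Im_divide cmod_power2 by (simp only:)
  qed
  have re: "\<phi> (cis t) = - of_real (cot (t / 2))" if "0 < t" "t < 2 * pi" for t
  proof -
    define h where "h = t / 2"
    have "0 < h" "h < pi"
      using that by (simp_all add: h_def)
    then have "sin h > 0"
      by (rule sin_gt_zero)
    \<comment> \<open>Half angles: numerator and denominator of \<open>\<phi> (cis t)\<close> share
      the factor \<open>cis h\<close>, leaving a quotient of a cosine by a sine.\<close>
    have c: "cis t = cis h * cis h" "1 = cis h * cis (- h)"
      by (simp_all add: cis_mult h_def)
    have "1 + cis t = cis h * (2 * of_real (cos h))"
      by (subst c(2), simp only: c(1), simp add: complex_eq_iff algebra_simps)
    moreover have "cis t - 1 = cis h * (2 * \<i> * of_real (sin h))"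
      by (subst c(2), simp only: c(1), simp add: complex_eq_iff algebra_simps)
    ultimately show ?thesis
      using \<open>sin h > 0\<close> unfolding \<phi>_def by (simp add: cot_def h_def[symmetric])
  qed
  have mono: "- cot (t / 2) < - cot (u / 2)" if "0 < t" "t < u" "u < 2 * pi" for t u :: real
  proof -
    have "sin (t / 2) > 0" "sin (u / 2) > 0" "sin (u / 2 - t / 2) > 0"
      using that by (auto intro!: sin_gt_zero simp del: diff_divide_distrib)
    then show ?thesis
      by (simp only: cot_def sin_diff) (simp add: field_simps)
  qed
  obtain f where f: "path f" "path_image f \<subseteq> A" "pathstart f = cis \<alpha>" "pathfinish f = cis \<gamma>"
    using pc(1) unfolding path_component_def by auto
  obtain g where g: "path g" "path_image g \<subseteq> B" "pathstart g = cis \<beta>" "pathfinish g = cis \<delta>"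
    using pc(2) unfolding path_component_def by auto
  have cont: "continuous_on (A \<union> B) \<phi>"
    unfolding \<phi>_def using A B by (intro continuous_intros) auto
  have up: "0 \<le> Im (\<phi> z)" if "z \<in> A \<union> B" for z
    using that A B by (auto simp: im power_le_one intro!: divide_nonneg_nonneg)
  have "path_image (\<phi> \<circ> f) \<inter> path_image (\<phi> \<circ> g) \<noteq> {}"
  proof (rule half_plane_paths_meet)
    show "path (\<phi> \<circ> f)" "path (\<phi> \<circ> g)"
      using f g cont by (auto intro!: path_continuous_image elim: continuous_on_subset)
    show "0 \<le> Im z" if "z \<in> path_image (\<phi> \<circ> f) \<union> path_image (\<phi> \<circ> g)" for z
      using that up f(2) g(2) by (auto simp: path_image_compose)
  qed (use f g order re mono in \<open>auto simp: pathstart_compose pathfinish_compose\<close>)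
  then obtain z z' where z: "z \<in> path_image f" "z' \<in> path_image g" "\<phi> z = \<phi> z'"
    by (auto simp: path_image_compose)
  then have "z = z'"
    using f(2) g(2) A B by (intro inj[OF z(3)]) blast+
  then show ?thesis
    using z f(2) g(2) by auto
qed

text \<open>The two sets may cover the whole unit circle, which leaves no room for the pole of a Moebius map
onto the half plane. They are therefore prolonged radially to the circle of radius \<open>2\<close>.\<close>
lemma disk_paths_meet:
  assumes pc: "path_component A (cis (- a)) (cis (- b))" "path_component B (cis (- c)) (cis (- d))"
    and A: "A \<subseteq> cball 0 1" and B: "B \<subseteq> cball 0 1"
    and order: "0 \<le> a" "a < c" "c < b" "b < d" "d < 2 * pi"
  shows "A \<inter> B \<noteq> {}"
proof
  assume disj: "A \<inter> B = {}"
  \<comment> \<open>Since \<open>d < s < 2 * pi\<close>, the point \<open>2 * cis (- s)\<close> lies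
    on none of the four rays. Rotating by \<open>s\<close> and halving with \<open>\<rho>\<close>
    moves it to \<open>1\<close>, the pole.\<close>
  define s where "s = (d + 2 * pi) / 2"
  define \<rho> where "\<rho> z = z * cis s / 2" for z :: complex
  define ray where "ray t = closed_segment (cis (- t)) (2 * cis (- t))" for t :: real
  have ray: "\<exists>r. 1 \<le> r \<and> r \<le> 2 \<and> z = of_real r * cis (- t)" if "z \<in> ray t" for z t
  proof -
    have "\<exists>u. 0 \<le> u \<and> u \<le> 1 \<and> z = (1 - u) *\<^sub>R cis (- t) + u *\<^sub>R (2 * cis (- t))"
      using that unfolding ray_def in_segment .
    then obtain u where "0 \<le> u" "u \<le> 1" "z = (1 - u) *\<^sub>R cis (- t) + u *\<^sub>R (2 * cis (- t))"
      by (elim exE conjE)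
    then show ?thesis
      by (intro exI[of _ "1 + u"]) (auto simp: scaleR_conv_of_real algebra_simps)
  qed
  define A' where "A' = A \<union> ray a \<union> ray b"
  define B' where "B' = B \<union> ray c \<union> ray d"
  have sd: "d < s" "s < 2 * pi"
    using order by (simp_all add: s_def)
  have inA: "cis (- a) \<in> A" "cis (- b) \<in> A" and inB: "cis (- c) \<in> B" "cis (- d) \<in> B"
    using pc path_component_mem by blast+
  have ext: "path_component (X \<union> ray t \<union> ray u) (2 * cis (- t)) (2 * cis (- u))"
    if "path_component X (cis (- t)) (cis (- u))" for X t u
  proof -
    have seg: "path_component (ray t) (cis (- t)) (2 * cis (- t))" for t
      by (metis ends_in_segment path_connected_component path_connected_segment ray_def)
    have "path_component (X \<union> ray t \<union> ray u) (2 * cis (- t)) (cis (- t))"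
      by (rule path_component_sym, rule path_component_of_subset[OF _ seg]) auto
    moreover have "path_component (X \<union> ray t \<union> ray u) (cis (- t)) (cis (- u))"
      by (rule path_component_of_subset[OF _ that]) auto
    moreover have "path_component (X \<union> ray t \<union> ray u) (cis (- u)) (2 * cis (- u))"
      by (rule path_component_of_subset[OF _ seg]) auto
    ultimately show ?thesis
      using path_component_trans by blast
  qed
  have cis_neq: "cis (- t) \<noteq> cis (- u)" if "0 \<le> t" "t < u" "u < 2 * pi" for t u
  proof
    assume "cis (- t) = cis (- u)"
    then have "cis t = cis u"
      by (simp flip: cis_cnj)
    then show False
      using cis_inj_2pi[of t u] that by auto
  qed
  have ray_ray: "ray t \<inter> ray u = {}" if "0 \<le> t" "t < u" "u < 2 * pi" for t u
  proof -
    have False if z: "z \<in> ray t" "z \<in> ray u" for z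
    proof -
      obtain r r' where r: "1 \<le> r" "z = of_real r * cis (- t)" and r': "1 \<le> r'" "z = of_real r' * cis (- u)"
        using ray[OF z(1)] ray[OF z(2)] by auto
      have "cmod z = r" "cmod z = r'"
        using arg_cong[OF r(2), of cmod] arg_cong[OF r'(2), of cmod] r(1) r'(1)
        by (simp_all add: norm_mult)
      then show False
        using r r' cis_neq[OF \<open>0 \<le> t\<close> \<open>t < u\<close> \<open>u < 2 * pi\<close>] by auto
    qed
    then show ?thesis
      by auto
  qed
  have ray_in: "z = cis (- t)" if z: "z \<in> ray t" "z \<in> cball 0 1" for z t
  proof -
    obtain r where "1 \<le> r" "z = of_real r * cis (- t)"
      using ray[OF z(1)] by auto
    with z(2) show ?thesis
      by (simp add: norm_mult)
  qed
  \<comment> \<open>A ray meets the unit disk only in its starting point, which already belongs to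
    the other of the two disjoint sets.\<close>
  have "A \<inter> ray c = {}" "A \<inter> ray d = {}"
    using ray_in[of _ c] ray_in[of _ d] A disj inB by blast+
  moreover have "ray a \<inter> B = {}" "ray b \<inter> B = {}"
    using ray_in[of _ a] ray_in[of _ b] B disj inA by blast+
  moreover have "ray a \<inter> ray c = {}" "ray a \<inter> ray d = {}" "ray b \<inter> ray c = {}" "ray b \<inter> ray d = {}"
    using order ray_ray[of a c] ray_ray[of a d] ray_ray[of c b] ray_ray[of b d]
    by (simp_all add: Int_commute)
  ultimately have disj': "A' \<inter> B' = {}"
    using disj by (simp add: A'_def B'_def Int_Un_distrib Int_Un_distrib2)
  have pole: "\<rho> ` (X \<union> ray t \<union> ray u) \<subseteq> cball 0 1 - {1}"
    if X: "X \<subseteq> cball 0 1" and tu: "0 \<le> t" "t \<le> d" "0 \<le> u" "u \<le> d" for X t u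
  proof -
    have X1: "\<rho> z \<in> cball 0 1 - {1}" if "cmod z \<le> 1" for z
    proof -
      have "cmod (\<rho> z) \<le> 1 / 2"
        using that by (simp add: \<rho>_def norm_mult norm_divide)
      then show ?thesis
        by (cases "\<rho> z = 1") auto
    qed
    have ray1: "\<rho> z \<in> cball 0 1 - {1}" if z: "z \<in> ray v" and v: "0 \<le> v" "v \<le> d" for z v
    proof -
      obtain r where r: "1 \<le> r" "r \<le> 2" "z = of_real r * cis (- v)"
        using ray[OF z] by auto
      have "cmod (\<rho> z) = r / 2"
        using r by (simp add: \<rho>_def norm_mult norm_divide)
      moreover have "\<rho> z \<noteq> 1"
      proof
        assume 1: "\<rho> z = 1"
        then have "r = 2"
          using \<open>cmod (\<rho> z) = r / 2\<close> by simp
        then have "cis (- v) * cis s = 1"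
          using 1 r by (simp add: \<rho>_def)
        then have "cis (- v) = cis (- s)"
          by (metis cis_inverse inverse_unique mult.commute)
        then show False
          using cis_neq[of v s] v sd by auto
      qed
      ultimately show ?thesis
        using r by auto
    qed
    show ?thesis
      using X1 ray1 X tu by (fastforce simp: subset_iff)
  qed
  have \<rho>_pc: "path_component (\<rho> ` X) (cis (s - t)) (cis (s - u))"
    if pc: "path_component X (2 * cis (- t)) (2 * cis (- u))" for X t u
  proof -
    obtain f where f: "path f" "path_image f \<subseteq> X" "pathstart f = 2 * cis (- t)" "pathfinish f = 2 * cis (- u)"
      using pc unfolding path_component_def by auto
    have "path (\<rho> \<circ> f)"
      using f(1) by (rule path_continuous_image) (auto simp: \<rho>_def intro!: continuous_intros)
    moreover have "\<rho> (2 * cis (- v)) = cis (s - v)" for v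
      by (simp add: \<rho>_def cis_mult)
    ultimately show ?thesis
      using f unfolding path_component_def
      by (intro exI[of _ "\<rho> \<circ> f"]) (auto simp: path_image_compose pathstart_compose pathfinish_compose)
  qed
  have "\<rho> ` A' \<inter> \<rho> ` B' \<noteq> {}"
  \<comment> \<open>Passing from \<open>- x\<close> to \<open>s - x\<close> makes the angles
    counterclockwise and reverses their order to \<open>s - d < s - b < s - c < s - a\<close>, so
    the two sets exchange roles.\<close>
  proof (subst Int_commute, rule disk_paths_meet_aux)
    show "path_component (\<rho> ` B') (cis (s - d)) (cis (s - c))"
      unfolding B'_def by (intro \<rho>_pc path_component_sym[OF ext] pc)
    show "path_component (\<rho> ` A') (cis (s - b)) (cis (s - a))"
      unfolding A'_def by (intro \<rho>_pc path_component_sym[OF ext] pc)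
    show "\<rho> ` B' \<subseteq> cball 0 1 - {1}" "\<rho> ` A' \<subseteq> cball 0 1 - {1}"
      unfolding A'_def B'_def by (rule pole; use A B order in simp)+
  qed (use order sd in auto)
  then show False
    using disj' by (auto simp: \<rho>_def)
qed

subsection \<open>Alternating colourings\<close>

primrec act :: "('a \<Rightarrow> 'a) \<Rightarrow> ('a \<Rightarrow> 'a) \<Rightarrow> bool list \<Rightarrow> 'a \<Rightarrow> 'a" where
  "act s t [] x = x"
| "act s t (b # bs) x = (if b then s else t) (act s t bs x)"

lemma act_append: "act s t (xs @ ys) x = act s t xs (act s t ys x)"
  by (induction xs) auto

text \<open>A word without equal neighbours alternates, and an alternating word of odd length begins
  and ends with the same letter. The two cases are the cancellation and the conjugation that shorten
  a word by two letters.\<close>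

lemma odd_adj_equal_or_ends_equal:
  assumes "odd (length (xs :: bool list))" "length xs \<noteq> 1"
  shows "(\<exists>ys b zs. xs = ys @ [b, b] @ zs) \<or> (\<exists>b ys. xs = b # ys @ [b])"
proof (cases "\<exists>i. Suc i < length xs \<and> xs ! i = xs ! Suc i")
  case True
  then obtain i where i: "Suc i < length xs" "xs ! i = xs ! Suc i"
    by blast
  then have "xs = take i xs @ [xs ! i, xs ! i] @ drop (Suc (Suc i)) xs"
    using id_take_nth_drop[of i xs] Cons_nth_drop_Suc[of "Suc i" xs] by simp
  then show ?thesis
    by blast
next
  case False
  have alt: "i < length xs \<Longrightarrow> xs ! i = (xs ! 0 \<noteq> odd i)" for i
    using False by (induction i) auto
  have "xs \<noteq> []"
    using assms by auto
  then have "last xs = hd xs"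
    using assms alt[of "length xs - 1"] by (simp add: last_conv_nth hd_conv_nth)
  obtain b ys where b: "xs = b # ys"
    using \<open>xs \<noteq> []\<close> by (cases xs) auto
  with assms have "ys \<noteq> []"
    by auto
  moreover have "last ys = b"
    using \<open>last xs = hd xs\<close> \<open>ys \<noteq> []\<close> b by simp
  ultimately have "xs = b # butlast ys @ [b]"
    using append_butlast_last_id[of ys] b by simp
  then show ?thesis
    by (intro disjI2 exI)
qed

locale free_involutions =
  fixes s t :: "'a \<Rightarrow> 'a"
  assumes invol: "s (s x) = x" "t (t x) = x"
    and free: "s x \<noteq> x" "t x \<noteq> x"
begin

lemma act_rev: "act s t (rev xs) (act s t xs x) = x"
  by (induction xs arbitrary: x) (auto simp: act_append invol)

text \<open>Words in two letters modulo cancellation and conjugation: every word of odd length is conjugate to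
a single letter.\<close>
lemma act_odd_neq: "odd (length xs) \<Longrightarrow> act s t xs x \<noteq> x"
proof (induction "length xs" arbitrary: xs x rule: less_induct)
  case less
  show ?case
  proof (cases "length xs = 1")
    case True
    then show ?thesis
      using free by (auto simp: length_Suc_conv split: if_splits)
  next
    case False
    from odd_adj_equal_or_ends_equal[OF less.prems False] show ?thesis
    proof (elim disjE exE)
      fix ys b zs assume xs: "xs = ys @ [b, b] @ zs"
      then have "act s t xs x = act s t (ys @ zs) x"
        by (auto simp: act_append invol)
      then show ?thesis
        using less.hyps[of "ys @ zs" x] less.prems xs by auto
    next
      fix b ys assume xs: "xs = b # ys @ [b]"
      define y where "y = act s t [b] x"
      have "act s t [b] (act s t xs x) = act s t ys y"
        by (auto simp: xs act_append y_def invol)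
      moreover have "act s t ys y \<noteq> y"
        using less.hyps[of ys y] less.prems xs by auto
      ultimately show ?thesis
        by (auto simp: y_def)
    qed
  qed
qed

text \<open>In every orbit a base point \<open>r x\<close> is chosen, and \<open>x\<close> is
  coloured by whether some even word leads to it. The choice depends only on the set
  \<open>reach x\<close>, hence is constant on orbits. If both \<open>x\<close> and its image under
  a letter had even words, going around through the base point would give an odd word fixing
  \<open>x\<close>.\<close>

lemma ex_alternating_colouring: "\<exists>c :: 'a \<Rightarrow> bool. \<forall>x. c (s x) = (\<not> c x) \<and> c (t x) = (\<not> c x)"
proof -
  define reach where "reach x = {z. \<exists>xs. act s t xs x = z}" for x
  define r where "r x = (SOME z. z \<in> reach x)" for x
  define c where "c x \<longleftrightarrow> (\<exists>xs. even (length xs) \<and> act s t xs x = r x)" for x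
  have r: "\<exists>xs. act s t xs x = r x" for x
  proof -
    have "x \<in> reach x"
      unfolding reach_def by (auto intro!: exI[of _ "[]"])
    then have "r x \<in> reach x"
      unfolding r_def by (rule someI)
    then show ?thesis
      by (auto simp: reach_def)
  qed
  have step: "c y = (\<not> c x)" if y: "y = act s t [b] x" for x y b
  proof -
    have x: "x = act s t [b] y"
      by (auto simp: y invol)
    have "reach x = reach y"
      unfolding reach_def by (metis act_append x y)
    then have rxy: "r x = r y"
      by (simp add: r_def)
    show ?thesis
    proof (cases "c x")
      case True
      then obtain xs where xs: "even (length xs)" "act s t xs x = r x"
        by (auto simp: c_def)
      have False if "even (length ys)" "act s t ys y = r y" for ys
      proof -
        have "act s t (rev xs @ ys @ [b]) x = x"
          using that xs rxy by (metis act_append act_rev y)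
        then show False
          using act_odd_neq[of "rev xs @ ys @ [b]" x] that xs by auto
      qed
      with True show ?thesis
        by (auto simp: c_def)
    next
      case False
      obtain xs where xs: "act s t xs x = r x"
        using r by blast
      with False have "odd (length xs)"
        by (auto simp: c_def)
      moreover have "act s t (xs @ [b]) y = r y"
        using xs x rxy by (simp only: act_append)
      ultimately show ?thesis
        using False unfolding c_def by (metis even_Suc length_append_singleton)
    qed
  qed
  have "c (s x) = (\<not> c x) \<and> c (t x) = (\<not> c x)" for x
    using step[of "s x" True x] step[of "t x" False x] by simp
  then show ?thesis
    by blast
qed

end

text \<open>A fibre with two elements is swapped and every other element is fixed, also outside
  \<open>S\<close>, so that the involution is total.\<close>

lemma fibre_involution:
  fixes f :: "'e \<Rightarrow> 'v"
  assumes S: "finite S" "\<And>e. e \<in> S \<Longrightarrow> card {g\<in>S. f g = f e} \<le> 2"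
  obtains \<sigma> where "\<And>e. \<sigma> (\<sigma> e) = e"
    and "\<And>e g. e \<in> S \<Longrightarrow> g \<in> S \<Longrightarrow> e \<noteq> g \<Longrightarrow> f e = f g \<Longrightarrow> \<sigma> e = g"
proof -
  define M where "M e g \<longleftrightarrow> e \<in> S \<and> g \<in> S \<and> e \<noteq> g \<and> f e = f g" for e g
  have uniq: "g = h" if "M e g" "M e h" for e g h
  proof (rule ccontr)
    assume "g \<noteq> h"
    then have "card {e, g, h} = 3"
      using that by (auto simp: M_def)
    moreover have "{e, g, h} \<subseteq> {g\<in>S. f g = f e}"
      using that by (auto simp: M_def)
    moreover have "finite {g\<in>S. f g = f e}"
      using S(1) by auto
    ultimately have "3 \<le> card {g\<in>S. f g = f e}"
      by (metis card_mono)
    then show False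
      using S(2)[of e] that by (auto simp: M_def)
  qed
  define \<sigma> where "\<sigma> e = (if \<exists>g. M e g then THE g. M e g else e)" for e
  have M: "\<sigma> e = g" if "M e g" for e g
    using that uniq by (auto simp: \<sigma>_def)
  have sym: "M g e" if "M e g" for e g
    using that by (auto simp: M_def)
  show thesis
  proof
    show "\<sigma> (\<sigma> e) = e" for e
    proof (cases "\<exists>g. M e g")
      case True
      then show ?thesis
        using M sym by metis
    qed (simp add: \<sigma>_def)
  qed (use M in \<open>auto simp: M_def\<close>)
qed

text \<open>Doubling the edge set and letting each fixed edge swap its two copies closes every path up to a
cycle, so that the involutions become fixed-point free.\<close>
lemma ex_two_edge_colouring:
  fixes f :: "'e \<Rightarrow> 'v" and g :: "'e \<Rightarrow> 'w"
  assumes "finite S" "\<And>e. e \<in> S \<Longrightarrow> card {h\<in>S. f h = f e} \<le> 2"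
    "\<And>e. e \<in> S \<Longrightarrow> card {h\<in>S. g h = g e} \<le> 2"
  shows "\<exists>c :: 'e \<Rightarrow> bool. \<forall>e\<in>S. \<forall>h\<in>S. e \<noteq> h \<and> (f e = f h \<or> g e = g h) \<longrightarrow> c e = (\<not> c h)"
proof -
  obtain \<sigma> where \<sigma>: "\<And>e. \<sigma> (\<sigma> e) = e"
    "\<And>e h. e \<in> S \<Longrightarrow> h \<in> S \<Longrightarrow> e \<noteq> h \<Longrightarrow> f e = f h \<Longrightarrow> \<sigma> e = h"
    using fibre_involution[OF assms(1,2)] by blast
  obtain \<tau> where \<tau>: "\<And>e. \<tau> (\<tau> e) = e"
    "\<And>e h. e \<in> S \<Longrightarrow> h \<in> S \<Longrightarrow> e \<noteq> h \<Longrightarrow> g e = g h \<Longrightarrow> \<tau> e = h"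
    using fibre_involution[OF assms(1,3)] by blast
  define lift :: "('e \<Rightarrow> 'e) \<Rightarrow> 'e \<times> bool \<Rightarrow> 'e \<times> bool"
    where "lift \<pi> = (\<lambda>(e, b). (\<pi> e, if \<pi> e = e then \<not> b else b))" for \<pi>
  have lift: "lift \<pi> (lift \<pi> x) = x" "lift \<pi> x \<noteq> x" if "\<And>e. \<pi> (\<pi> e) = e" for \<pi> x
  proof -
    obtain e b where x: "x = (e, b)"
      by (cases x)
    have "\<pi> (\<pi> e) = e"
      by (rule that)
    then show "lift \<pi> (lift \<pi> x) = x" "lift \<pi> x \<noteq> x"
      by (cases "\<pi> e = e"; simp add: lift_def x)+
  qed
  interpret free_involutions "lift \<sigma>" "lift \<tau>"
    by unfold_locales (rule lift, rule \<sigma> \<tau>)+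
  obtain c where c: "\<And>x. c (lift \<sigma> x) = (\<not> c x)" "\<And>x. c (lift \<tau> x) = (\<not> c x)"
    using ex_alternating_colouring by blast
  \<comment> \<open>An edge that is moved by an involution keeps its copy, so the colours on one of
    the two copies suffice.\<close>
  have "c (e, False) = (\<not> c (h, False))" if "e \<in> S" "h \<in> S" "e \<noteq> h" "f e = f h \<or> g e = g h" for e h
  proof -
    have "lift \<sigma> (e, False) = (h, False) \<or> lift \<tau> (e, False) = (h, False)"
      using that \<sigma>(2) \<tau>(2) by (auto simp: lift_def)
    then show ?thesis
      using c by metis
  qed
  then show ?thesis
    by (intro exI[of _ "\<lambda>e. c (e, False)"]) auto
qed

subsection \<open>Components of edge sets\<close>

locale pb_graph =
  fixes N :: "('v, 'e) pbgraph"
  assumes graph: "is_pbgraph N"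
begin

lemma finite_edg: "finite (edg N)"
  using graph by (auto simp: is_pbgraph_def)

lemma finite_bverts: "finite (bverts N)"
  by (simp add: bverts_def)

lemma inj_bdv: "inj_on (bdv N) {1..nb N}"
  using graph by (auto simp: is_pbgraph_def)

lemma bdv_eq_iff: "i \<in> {1..nb N} \<Longrightarrow> j \<in> {1..nb N} \<Longrightarrow> bdv N i = bdv N j \<longleftrightarrow> i = j"
  using inj_bdv by (auto dest: inj_onD)

lemma bdv_in_bverts: "i \<in> {1..nb N} \<Longrightarrow> bdv N i \<in> bverts N"
  by (auto simp: bverts_def)

lemma intv_bverts_disjoint: "v \<in> intv N \<Longrightarrow> v \<notin> bverts N"
  using graph by (auto simp: is_pbgraph_def)

lemma edge_ends:
  assumes "e \<in> edg N"
  shows "blk N (bend N e)" "\<not> blk N (wend N e)"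
    "bend N e \<in> intv N \<union> bverts N" "wend N e \<in> intv N \<union> bverts N"
    "bend N e \<in> intv N \<or> wend N e \<in> intv N"
  using graph assms by (auto simp: is_pbgraph_def)

lemma ends_cases: "e \<in> edg N \<Longrightarrow> x \<in> ends N e \<Longrightarrow> x \<in> intv N \<or> x \<in> bverts N"
  using edge_ends by (auto simp: ends_def)

lemma ends_int: "e \<in> edg N \<Longrightarrow> \<exists>v\<in>ends N e. v \<in> intv N"
  using edge_ends by (auto simp: ends_def)

lemma finite_ends: "finite (ends N e)"
  by (simp add: ends_def)

lemma card_ends: "e \<in> edg N \<Longrightarrow> card (ends N e) = 2"
  using edge_ends[of e] by (auto simp: ends_def card_insert_if)

text \<open>A shared vertex has one colour, so it is the black end of both edges or the white end of
  both. Adjacency thus splits into the two fibre relations that the colouring by two involutions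
  requires.\<close>

lemma ends_meet_iff:
  assumes "e \<in> edg N" "f \<in> edg N"
  shows "ends N e \<inter> ends N f \<noteq> {} \<longleftrightarrow> bend N e = bend N f \<or> wend N e = wend N f"
  using edge_ends(1,2)[OF assms(1)] edge_ends(1,2)[OF assms(2)] by (auto simp: ends_def)

lemma bdry_unique:
  assumes "i \<in> {1..nb N}"
  shows "\<exists>!e. e \<in> edg N \<and> bdv N i \<in> ends N e"
proof -
  have "card (incid N (edg N) (bdv N i)) = 1"
    using graph assms by (auto simp: is_pbgraph_def deg_def)
  then obtain e where "incid N (edg N) (bdv N i) = {e}"
    by (auto simp: card_1_singleton_iff)
  then have "f \<in> edg N \<and> bdv N i \<in> ends N f \<longleftrightarrow> f = e" for f
    unfolding incid_def by blast
  then show ?thesis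
    by simp
qed

text \<open>The degree-one condition on the boundary lets every statement about boundary vertices be
  read as membership of this single edge.\<close>

definition bedge :: "nat \<Rightarrow> 'e" where
  "bedge i = (THE e. e \<in> edg N \<and> bdv N i \<in> ends N e)"

lemma bedge:
  assumes "i \<in> {1..nb N}"
  shows "bedge i \<in> edg N" "bdv N i \<in> ends N (bedge i)"
  using theI'[OF bdry_unique[OF assms]] by (simp_all add: bedge_def)

lemma bedge_eq: "i \<in> {1..nb N} \<Longrightarrow> e \<in> edg N \<Longrightarrow> bdv N i \<in> ends N e \<Longrightarrow> e = bedge i"
  using bdry_unique bedge by blast

lemma shared_end_int:
  assumes "e \<in> edg N" "f \<in> edg N" "e \<noteq> f" "x \<in> ends N e" "x \<in> ends N f"
  shows "x \<in> intv N"
proof (rule ccontr)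
  assume "x \<notin> intv N"
  then obtain i where "i \<in> {1..nb N}" "x = bdv N i"
    using ends_cases assms by (fastforce simp: bverts_def)
  then show False
    using bedge_eq assms by metis
qed

lemma incid_bdv:
  assumes "i \<in> {1..nb N}" "F \<subseteq> edg N"
  shows "incid N F (bdv N i) = {bedge i} \<inter> F"
proof -
  have "e \<in> F \<and> bdv N i \<in> ends N e \<longleftrightarrow> e \<in> F \<and> e = bedge i" for e
    using bedge_eq[OF assms(1), of e] bedge[OF assms(1)] assms(2) by blast
  then show ?thesis
    unfolding incid_def by blast
qed

text \<open>Written as an equivalence, the asymmetry between black and white disappears: adding or
  removing \<open>bedge i\<close> toggles the label \<open>i\<close> for either colour.\<close>

lemma Ilab_iff:
  assumes "F \<subseteq> edg N"
  shows "i \<in> Ilab N F \<longleftrightarrow> i \<in> {1..nb N} \<and> (blk N (bdv N i) \<longleftrightarrow> bedge i \<in> F)"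
proof (cases "i \<in> {1..nb N}")
  case True
  have "incid N F (bdv N i) = {} \<longleftrightarrow> bedge i \<notin> F"
    using incid_bdv[OF True assms] by simp
  with True show ?thesis
    unfolding Ilab_def by simp blast
qed (auto simp: Ilab_def)

lemma eadj_sym: "sym (eadj N S)"
  by (auto simp: sym_def eadj_def)

lemma comps_subset: "C \<in> comps N S \<Longrightarrow> C \<subseteq> S"
proof -
  have "f \<in> S" if "(e, f) \<in> (eadj N S)\<^sup>*" "e \<in> S" for e f
    using that by (induction) (auto simp: eadj_def)
  then show "C \<in> comps N S \<Longrightarrow> C \<subseteq> S"
    by (auto simp: comps_def)
qed

lemma comps_eq:
  assumes "C \<in> comps N S" "e \<in> C"
  shows "C = {f. (e, f) \<in> (eadj N S)\<^sup>*}"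
proof -
  obtain e0 where C: "C = {f. (e0, f) \<in> (eadj N S)\<^sup>*}"
    using assms by (auto simp: comps_def)
  with assms have "(e0, e) \<in> (eadj N S)\<^sup>*" "(e, e0) \<in> (eadj N S)\<^sup>*"
    using sym_rtrancl[OF eadj_sym] by (auto dest: symD)
  then show ?thesis
    unfolding C by (auto intro: rtrancl_trans)
qed

lemma comps_nonempty: "C \<in> comps N S \<Longrightarrow> C \<noteq> {}"
  by (auto simp: comps_def)

lemma comps_unique: "C \<in> comps N S \<Longrightarrow> D \<in> comps N S \<Longrightarrow> e \<in> C \<Longrightarrow> e \<in> D \<Longrightarrow> C = D"
  using comps_eq by metis

lemma comps_cover: "e \<in> S \<Longrightarrow> \<exists>C\<in>comps N S. e \<in> C"
  by (auto simp: comps_def)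

lemma Union_comps: "\<Union> (comps N S) = S"
  using comps_subset comps_cover by blast

lemma comps_closed:
  assumes "C \<in> comps N S" "e \<in> C" "f \<in> S" "x \<in> ends N e" "x \<in> ends N f"
  shows "f \<in> C"
proof -
  have "(e, f) \<in> eadj N S"
    using assms comps_subset by (fastforce simp: eadj_def)
  then show ?thesis
    using comps_eq[OF assms(1,2)] by auto
qed

text \<open>Propagation along shared vertices takes the place of walking along a path or cycle; the
  shared vertex is made explicit and both edges are kept inside \<open>C\<close>.\<close>

lemma comps_induct [consumes 3, case_names base step]:
  assumes "C \<in> comps N S" "e \<in> C" "h \<in> C"
    and base: "Pr e"
    and step: "\<And>f g x. f \<in> C \<Longrightarrow> g \<in> C \<Longrightarrow> Pr f \<Longrightarrow> x \<in> ends N f \<Longrightarrow> x \<in> ends N g \<Longrightarrow> Pr g"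
  shows "Pr h"
proof -
  have "(e, h) \<in> (eadj N S)\<^sup>*"
    using comps_eq[OF assms(1,2)] assms(3) by auto
  then have "h \<in> C \<and> Pr h"
  proof (induction)
    case (step f g)
    then have "g \<in> C"
      using comps_closed[OF assms(1), of f g] by (auto simp: eadj_def)
    with step.hyps step.IH show ?case
      using assms(5)[of f g] by (auto simp: eadj_def)
  qed (use assms(2,4) in simp)
  then show ?thesis ..
qed

lemma cverts_disjoint:
  assumes "C \<in> comps N S" "D \<in> comps N S" "C \<noteq> D"
  shows "cverts N C \<inter> cverts N D = {}"
proof -
  have False if "e \<in> C" "f \<in> D" "x \<in> ends N e" "x \<in> ends N f" for x e f
    using comps_closed[OF assms(1) that(1) _ that(3,4)] comps_unique[OF assms(1,2)]
      comps_subset[OF assms(2)] that(2) assms(3) by blast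
  then show ?thesis
    by (auto simp: cverts_def)
qed

lemma incid_comp:
  assumes "C \<in> comps N S" "x \<in> cverts N C"
  shows "incid N S x = incid N C x"
  using comps_closed[OF assms(1)] comps_subset[OF assms(1)] assms(2)
  by (fastforce simp: incid_def cverts_def)

lemma finite_comp: "S \<subseteq> edg N \<Longrightarrow> C \<in> comps N S \<Longrightarrow> finite C"
  using comps_subset finite_edg by (meson finite_subset)

lemma finite_comps: "S \<subseteq> edg N \<Longrightarrow> finite (comps N S)"
  using finite_edg by (auto simp: comps_def intro: finite_subset)

lemma finite_cverts: "finite C \<Longrightarrow> finite (cverts N C)"
  by (auto simp: cverts_def finite_ends)

lemma cverts_cases: "C \<subseteq> edg N \<Longrightarrow> x \<in> cverts N C \<Longrightarrow> x \<in> intv N \<or> x \<in> bverts N"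
  using ends_cases by (auto simp: cverts_def)

text \<open>The bound V \<le> E + 1 for connected graphs. A maximal edge subset containing
  \<open>e\<close> and obeying the bound is all of \<open>C\<close>, since an edge touching it adds
  at most one vertex and could be included.\<close>

lemma card_cverts_le:
  assumes "S \<subseteq> edg N" "C \<in> comps N S"
  shows "card (cverts N C) \<le> card C + 1"
proof -
  obtain e where e: "e \<in> C"
    using comps_nonempty assms by blast
  have finC: "finite C"
    using finite_comp assms by blast
  define \<F> where "\<F> = {F. F \<subseteq> C \<and> e \<in> F \<and> card (cverts N F) \<le> card F + 1}"
  have CE: "C \<subseteq> edg N"
    using comps_subset assms by blast
  have "{e} \<in> \<F>"
    using e CE card_ends by (auto simp: \<F>_def cverts_def)
  moreover have "finite \<F>"
    using finC by (auto simp: \<F>_def)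
  ultimately obtain F where F: "F \<in> \<F>" "\<And>G. G \<in> \<F> \<Longrightarrow> F \<subseteq> G \<Longrightarrow> F = G"
    using finite_has_maximal[of \<F>] by blast
  have "h \<in> F" if "h \<in> C" for h
    using assms(2) e that
  proof (induction rule: comps_induct[where Pr = "\<lambda>h. h \<in> F"])
    case (step f g x)
    show ?case
    proof (rule ccontr)
      assume "g \<notin> F"
      have "finite F"
        using F(1) finC by (auto simp: \<F>_def intro: finite_subset)
      have "cverts N (insert g F) = cverts N F \<union> (ends N g - {x})"
        using step by (auto simp: cverts_def)
      then have "card (cverts N (insert g F)) \<le> card (cverts N F) + card (ends N g - {x})"
        by (simp add: card_Un_le)
      also have "\<dots> \<le> card (insert g F) + 1"
        using F(1) step CE card_ends[of g] \<open>finite F\<close> \<open>g \<notin> F\<close> by (auto simp: \<F>_def)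
      finally have "insert g F \<in> \<F>"
        using F(1) step by (auto simp: \<F>_def)
      then show False
        using F(2) \<open>g \<notin> F\<close> by blast
    qed
  qed (use F in \<open>auto simp: \<F>_def\<close>)
  then have "F = C"
    using F(1) by (auto simp: \<F>_def)
  with F(1) show ?thesis
    by (auto simp: \<F>_def)
qed

text \<open>Double counting of incidences, for general summands because it serves both the degree
  sum and the signed sum along a path.\<close>

lemma sum_incid_swap:
  fixes h :: "'e \<Rightarrow> 'v \<Rightarrow> 'b::comm_monoid_add"
  assumes "finite C"
  shows "(\<Sum>x\<in>cverts N C. \<Sum>e\<in>incid N C x. h e x) = (\<Sum>e\<in>C. \<Sum>x\<in>ends N e. h e x)"
proof -
  have "(\<Sum>x\<in>cverts N C. \<Sum>e\<in>incid N C x. h e x) = (\<Sum>e\<in>C. \<Sum>x\<in>{x\<in>cverts N C. x \<in> ends N e}. h e x)"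
    unfolding incid_def by (rule sum.swap_restrict[OF finite_cverts[OF assms] assms])
  also have "\<dots> = (\<Sum>e\<in>C. \<Sum>x\<in>ends N e. h e x)"
    by (rule sum.cong[OF refl], rule sum.cong) (auto simp: cverts_def)
  finally show ?thesis .
qed

lemma sum_deg:
  assumes "C \<subseteq> edg N" "finite C"
  shows "(\<Sum>x\<in>cverts N C. deg N C x) = 2 * card C"
proof -
  have "(\<Sum>e\<in>C. card (ends N e)) = (\<Sum>e\<in>C. 2)"
    using assms(1) card_ends by (intro sum.cong) auto
  then show ?thesis
    using sum_incid_swap[OF assms(2), of "\<lambda>_ _. 1 :: nat"] by (simp add: deg_def)
qed

section \<open>Local description of Temperley--Lieb subgraphs\<close>

definition lone :: "'e set \<Rightarrow> 'e set" where
  "lone S = {e \<in> S. \<forall>f\<in>S. ends N e \<inter> ends N f \<noteq> {} \<longrightarrow> f = e}"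

lemma lone_comp:
  assumes "C \<in> comps N S" "e \<in> C" "e \<in> lone S"
  shows "C = {e}"
proof -
  have "h = e" if "h \<in> C" for h
    using assms(1,2) that
  proof (induction rule: comps_induct[where Pr = "\<lambda>h. h = e"])
    case (step f g x)
    then show ?case
      using assms(3) comps_subset[OF assms(1)] by (auto simp: lone_def)
  qed auto
  then show ?thesis
    using assms(2) by blast
qed

lemma card_1_comp_iff:
  assumes "C \<in> comps N S" "e \<in> C"
  shows "card C = 1 \<longleftrightarrow> e \<in> lone S"
proof
  assume "card C = 1"
  then have "C = {e}"
    using assms(2) by (auto simp: card_1_singleton_iff)
  then show "e \<in> lone S"
    using comps_closed[OF assms(1)] comps_subset[OF assms(1)] by (fastforce simp: lone_def)
qed (use lone_comp[OF assms] in auto)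

text \<open>The component clause of \<open>is_TL\<close> is replaced by a degree condition, which
  can be checked vertex by vertex on a union of dimer configurations. The equivalence is
  \<open>is_TL_iff\<close>.\<close>

definition locTL :: "'e set \<Rightarrow> bool" where
  "locTL S \<longleftrightarrow> S \<subseteq> edg N \<and> (\<forall>v\<in>intv N. incid N S v \<noteq> {}) \<and>
     (\<forall>e\<in>S - lone S. \<forall>v\<in>ends N e \<inter> intv N. deg N S v = 2)"

lemma is_TL_imp_locTL:
  assumes "is_TL N S"
  shows "locTL S"
proof -
  have "deg N S v = 2" if "e \<in> S" "e \<notin> lone S" "v \<in> ends N e" "v \<in> intv N" for e v
  proof -
    obtain C where C: "C \<in> comps N S" "e \<in> C"
      using comps_cover \<open>e \<in> S\<close> by blast
    then have "card C \<noteq> 1" "v \<in> cverts N C" "v \<notin> bverts N"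
      using card_1_comp_iff that intv_bverts_disjoint by (auto simp: cverts_def)
    then show ?thesis
      using assms C by (auto simp: is_TL_def is_bpath_def is_icycle_def)
  qed
  then show ?thesis
    using assms by (auto simp: locTL_def is_TL_def)
qed

lemma deg_bdry:
  assumes "S \<subseteq> edg N" "C \<in> comps N S" "x \<in> cverts N C" "x \<in> bverts N"
  shows "deg N S x = 1"
proof -
  obtain i where i: "i \<in> {1..nb N}" "x = bdv N i"
    using assms by (auto simp: bverts_def)
  obtain e where "e \<in> C" "x \<in> ends N e"
    using assms by (auto simp: cverts_def)
  then have "incid N S x = {bedge i}"
    using i assms bedge_eq[of i e] comps_subset[OF assms(2)] by (auto simp: incid_bdv)
  then show ?thesis
    by (simp add: deg_def)
qed

text \<open>With \<open>b\<close> boundary vertices of degree 1 and all other degrees 2, the degree sum is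
\<open>2 E = 2 V - b\<close>, and connectedness gives \<open>V \<le> E + 1\<close>; so \<open>b\<close> is
even and at most 2.\<close>
lemma comp_shape:
  assumes "locTL S" "C \<in> comps N S" "card C \<noteq> 1"
  shows "is_icycle N S C \<or> is_bpath N S C" "is_icycle N S C \<longleftrightarrow> cverts N C \<inter> bverts N = {}"
proof -
  have S: "S \<subseteq> edg N"
    using assms(1) by (simp add: locTL_def)
  have CE: "C \<subseteq> edg N" and fin: "finite C" "finite (cverts N C)"
    using comps_subset finite_comp S assms finite_cverts by blast+
  have d2: "deg N S x = 2" if x: "x \<in> cverts N C" "x \<notin> bverts N" for x
  proof -
    obtain e where e: "e \<in> C" "x \<in> ends N e"
      using x by (auto simp: cverts_def)
    then have "e \<notin> lone S" "x \<in> intv N" "e \<in> S"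
      using card_1_comp_iff assms cverts_cases[OF CE] that comps_subset by blast+
    with e assms(1) show ?thesis
      by (auto simp: locTL_def)
  qed
  have d1: "deg N S x = 1" if "x \<in> cverts N C" "x \<in> bverts N" for x
    using deg_bdry S assms that by blast
  let ?B = "cverts N C \<inter> bverts N" and ?I = "cverts N C - bverts N"
  have "2 * card C = (\<Sum>x\<in>cverts N C. deg N S x)"
    unfolding sum_deg[OF CE fin(1), symmetric] deg_def using incid_comp assms by (intro sum.cong) auto
  also have "\<dots> = (\<Sum>x\<in>?B. deg N S x) + (\<Sum>x\<in>?I. deg N S x)"
    using fin by (subst sum.union_disjoint[symmetric]) (auto intro!: sum.cong)
  also have "\<dots> = card ?B + 2 * card ?I"
    using d1 d2 by simp
  finally have 1: "2 * card C = card ?B + 2 * card ?I" .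
  have "card (cverts N C) = card ?B + card ?I"
    using fin by (subst card_Un_disjoint[symmetric]) (auto intro!: arg_cong[of _ _ card])
  with 1 card_cverts_le[OF S assms(2)] have "card ?B \<le> 2" "even (card ?B)"
    by presburger+
  then have B: "card ?B = 0 \<or> card ?B = 2"
    by (metis One_nat_def even_Suc le_Suc_eq le_zero_eq numeral_2_eq_2 odd_one)
  then have B': "?B = {} \<or> card ?B = 2"
    using fin by auto
  show iff: "is_icycle N S C \<longleftrightarrow> ?B = {}"
    using d2 cverts_cases[OF CE] intv_bverts_disjoint unfolding is_icycle_def by blast
  show "is_icycle N S C \<or> is_bpath N S C"
    using B' iff d1 d2 by (auto simp: is_bpath_def)
qed

lemma is_TL_iff: "is_TL N S \<longleftrightarrow> locTL S"
proof
  assume S: "locTL S"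
  then have "card C = 1 \<or> is_bpath N S C \<or> is_icycle N S C" if "C \<in> comps N S" for C
    using comp_shape(1)[OF S that] by blast
  with S show "is_TL N S"
    unfolding is_TL_def locTL_def by blast
qed (rule is_TL_imp_locTL)

subsection \<open>Pairs of dimer configurations\<close>

definition alternating :: "'e set \<Rightarrow> 'e set \<Rightarrow> bool" where
  "alternating S P \<longleftrightarrow> lone S \<subseteq> P \<and> P \<subseteq> S \<and>
     (\<forall>e\<in>S. \<forall>f\<in>S. e \<noteq> f \<and> ends N e \<inter> ends N f \<noteq> {} \<longrightarrow> (e \<in> P \<longleftrightarrow> f \<notin> P))"

text \<open>The second member of a pair with union \<open>S\<close>, recovered from the first: the
  complement, except that single edges belong to both members.\<close>

definition partner :: "'e set \<Rightarrow> 'e set \<Rightarrow> 'e set" where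
  "partner S P = (S - P) \<union> lone S"

lemma alternatingD:
  assumes "alternating S P"
  shows "lone S \<subseteq> P" "P \<subseteq> S"
    "e \<in> S \<Longrightarrow> f \<in> S \<Longrightarrow> e \<noteq> f \<Longrightarrow> x \<in> ends N e \<Longrightarrow> x \<in> ends N f \<Longrightarrow> e \<in> P \<longleftrightarrow> f \<notin> P"
proof -
  show "lone S \<subseteq> P" "P \<subseteq> S"
    using assms by (simp_all add: alternating_def)
  assume *: "e \<in> S" "f \<in> S" "e \<noteq> f" "x \<in> ends N e" "x \<in> ends N f"
  then have "ends N e \<inter> ends N f \<noteq> {}"
    by blast
  with * show "e \<in> P \<longleftrightarrow> f \<notin> P"
    using assms unfolding alternating_def by meson
qed

lemma loneD: "e \<in> lone S \<Longrightarrow> f \<in> S \<Longrightarrow> x \<in> ends N e \<Longrightarrow> x \<in> ends N f \<Longrightarrow> f = e"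
  unfolding lone_def by blast

lemma lone_subset: "lone S \<subseteq> S"
  by (auto simp: lone_def)

lemma partner_Un: "alternating S P \<Longrightarrow> P \<union> partner S P = S"
  using alternatingD(1,2)[of S P] lone_subset[of S] unfolding partner_def by blast

lemma partner_Int: "alternating S P \<Longrightarrow> P \<inter> partner S P = lone S"
  using alternatingD(1,2)[of S P] lone_subset[of S] unfolding partner_def by blast

lemma dimer_ex:
  assumes "is_dimer N P" "v \<in> intv N"
  shows "\<exists>e. incid N P v = {e}"
  using assms by (auto simp: is_dimer_def deg_def card_1_singleton_iff)

lemma dimer_unique:
  assumes "is_dimer N P" "e \<in> P" "f \<in> P" "x \<in> ends N e" "x \<in> ends N f"
  shows "e = f"
proof (rule ccontr)
  assume "e \<noteq> f"
  then have "x \<in> intv N"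
    using shared_end_int[of e f x] assms by (auto simp: is_dimer_def)
  then obtain g where "incid N P x = {g}"
    using dimer_ex assms(1) by blast
  then have "e = g" "f = g"
    using assms unfolding incid_def by blast+
  with \<open>e \<noteq> f\<close> show False
    by simp
qed

text \<open>A common edge touches no other edge of either configuration. Conversely, an isolated
  edge has an interior end, since no edge joins two boundary vertices; both configurations must
  cover that end, and no other edge is available.\<close>

lemma dimers_Int:
  assumes P: "is_dimer N P" and Q: "is_dimer N Q"
  shows "P \<inter> Q = lone (P \<union> Q)"
proof
  show "P \<inter> Q \<subseteq> lone (P \<union> Q)"
    using dimer_unique[OF P] dimer_unique[OF Q] unfolding lone_def by blast
  have "e \<in> P'" if e: "e \<in> lone (P \<union> Q)" and P': "is_dimer N P'" "P' \<subseteq> P \<union> Q" for e P'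
  proof -
    have "e \<in> edg N"
      using e lone_subset[of "P \<union> Q"] P Q unfolding is_dimer_def by blast
    then obtain v where v: "v \<in> ends N e" "v \<in> intv N"
      using ends_int by blast
    then obtain g where "incid N P' v = {g}"
      using dimer_ex[OF P'(1)] by blast
    then have "g \<in> P'" "v \<in> ends N g"
      by (auto simp: incid_def)
    with loneD[OF e, of g v] P'(2) v show ?thesis
      by blast
  qed
  then show "lone (P \<union> Q) \<subseteq> P \<inter> Q"
    using P Q by blast
qed

lemma dimers_alternating:
  assumes P: "is_dimer N P" and Q: "is_dimer N Q"
  shows "alternating (P \<union> Q) P" "partner (P \<union> Q) P = Q"
proof -
  have "e \<in> P \<longleftrightarrow> f \<notin> P"
    if "e \<in> P \<union> Q" "f \<in> P \<union> Q" "e \<noteq> f" "ends N e \<inter> ends N f \<noteq> {}" for e f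
    using dimer_unique[OF P, of e f] dimer_unique[OF Q, of e f] that by blast
  then show "alternating (P \<union> Q) P"
    using dimers_Int[OF P Q] unfolding alternating_def by blast
  show "partner (P \<union> Q) P = Q"
    using dimers_Int[OF P Q] unfolding partner_def by blast
qed

lemma dimers_locTL:
  assumes P: "is_dimer N P" and Q: "is_dimer N Q"
  shows "locTL (P \<union> Q)"
proof -
  have U: "incid N (P \<union> Q) v = incid N P v \<union> incid N Q v" for v
    by (auto simp: incid_def)
  have "deg N (P \<union> Q) v = 2"
    if e: "e \<in> P \<union> Q" "e \<notin> lone (P \<union> Q)" "v \<in> ends N e" and v: "v \<in> intv N" for e v
  proof -
    obtain p q where pq: "incid N P v = {p}" "incid N Q v = {q}"
      using dimer_ex[OF P v] dimer_ex[OF Q v] by blast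
    have "p \<noteq> q"
    proof
      assume "p = q"
      then have "e = p"
        using e pq U[of v] by (auto simp: incid_def)
      moreover have "p \<in> P \<inter> Q"
        using pq \<open>p = q\<close> by (auto simp: incid_def)
      ultimately show False
        using e(2) dimers_Int[OF P Q] by simp
    qed
    then show ?thesis
      unfolding deg_def U pq by simp
  qed
  moreover have "incid N (P \<union> Q) v \<noteq> {}" if "v \<in> intv N" for v
    using U dimer_ex[OF P that] by auto
  ultimately show ?thesis
    using P Q unfolding locTL_def is_dimer_def by blast
qed

text \<open>At an interior vertex of degree two, alternation gives one edge to \<open>P\<close> and
  the other to its partner; a single edge is given to both.\<close>

lemma alternating_dimers:
  assumes S: "locTL S" and P: "alternating S P"
  shows "is_dimer N P" "is_dimer N (partner S P)"
proof -
  have "deg N P v = 1 \<and> deg N (partner S P) v = 1" if v: "v \<in> intv N" for v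
  proof -
    obtain e where e: "e \<in> S" "v \<in> ends N e"
      using S v unfolding locTL_def incid_def by blast
    have sub: "incid N F v = incid N S v \<inter> F" if "F \<subseteq> S" for F
      using that unfolding incid_def by blast
    have PS: "P \<subseteq> S" "partner S P \<subseteq> S"
      using alternatingD(2)[OF P] lone_subset unfolding partner_def by blast+
    show ?thesis
    proof (cases "e \<in> lone S")
      case True
      then have "incid N S v = {e}"
        using e loneD unfolding incid_def by blast
      moreover have "e \<in> P" "e \<in> partner S P"
        using True alternatingD(1)[OF P] by (auto simp: partner_def)
      ultimately show ?thesis
        unfolding deg_def sub[OF PS(1)] sub[OF PS(2)] by simp
    next
      case False
      then have "card (incid N S v) = 2"
        using S e v unfolding locTL_def deg_def by blast
      moreover have "e \<in> incid N S v"
        using e by (simp add: incid_def)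
      ultimately obtain f where f: "f \<noteq> e" "incid N S v = {e, f}"
        unfolding card_2_iff by (metis doubleton_eq_iff insertE singletonD)
      then have fS: "f \<in> S" "v \<in> ends N f"
        by (auto simp: incid_def)
      have "f \<notin> lone S"
        using loneD e fS f(1) by blast
      have "e \<in> P \<longleftrightarrow> f \<notin> P"
        using alternatingD(3)[OF P e(1) fS(1) _ e(2) fS(2)] f(1) by blast
      then show ?thesis
        unfolding deg_def sub[OF PS(1)] sub[OF PS(2)] f(2)
        using False \<open>f \<notin> lone S\<close> e(1) fS(1) f(1)
        by (cases "e \<in> P") (auto simp: partner_def)
    qed
  qed
  moreover have "P \<subseteq> edg N" "partner S P \<subseteq> edg N"
    using S alternatingD(2)[OF P] lone_subset unfolding locTL_def partner_def by blast+
  ultimately show "is_dimer N P" "is_dimer N (partner S P)"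
    by (auto simp: is_dimer_def)
qed

lemma deg_le_2:
  assumes S: "locTL S" and e: "e \<in> S" "x \<in> ends N e"
  shows "deg N S x \<le> 2"
proof -
  have eE: "e \<in> edg N" and SE: "S \<subseteq> edg N"
    using S e by (auto simp: locTL_def)
  obtain C where C: "C \<in> comps N S" "e \<in> C"
    using comps_cover e by blast
  consider "x \<in> bverts N" | "x \<in> intv N" "e \<in> lone S" | "x \<in> intv N" "e \<notin> lone S"
    using ends_cases[OF eE e(2)] by blast
  then show ?thesis
  proof cases
    case 1
    moreover have "x \<in> cverts N C"
      using C(2) e(2) by (auto simp: cverts_def)
    ultimately show ?thesis
      using deg_bdry[OF SE C(1)] by simp
  next
    case 2
    then have "incid N S x = {e}"
      using e loneD unfolding incid_def by blast
    then show ?thesis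
      by (simp add: deg_def)
  next
    case 3
    then have "deg N S x = 2"
      using S e unfolding locTL_def by blast
    then show ?thesis
      by simp
  qed
qed

lemma ex_alternating:
  assumes S: "locTL S"
  shows "\<exists>P. alternating S P"
proof -
  have SE: "S \<subseteq> edg N"
    using S by (simp add: locTL_def)
  then have fin: "finite S"
    using finite_edg finite_subset by blast
  have deg: "card {h\<in>S. u h = u e} \<le> 2" if "e \<in> S" "\<And>h. u h \<in> ends N h" for u e
  proof -
    have "{h\<in>S. u h = u e} \<subseteq> incid N S (u e)"
    proof
      fix h assume "h \<in> {h\<in>S. u h = u e}"
      with that(2)[of h] show "h \<in> incid N S (u e)"
        by (simp add: incid_def)
    qed
    then have "card {h\<in>S. u h = u e} \<le> deg N S (u e)"
      unfolding deg_def by (rule card_mono[rotated]) (use fin in \<open>simp add: incid_def\<close>)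
    also have "\<dots> \<le> 2"
      using deg_le_2[OF S that(1) that(2)] .
    finally show ?thesis .
  qed
  obtain c where c: "\<forall>e\<in>S. \<forall>h\<in>S. e \<noteq> h \<and> (bend N e = bend N h \<or> wend N e = wend N h) \<longrightarrow> c e = (\<not> c h)"
    using ex_two_edge_colouring[OF fin, of "bend N" "wend N"] deg[of _ "bend N"] deg[of _ "wend N"]
    by (auto simp: ends_def)
  \<comment> \<open>The colour that \<open>c\<close> assigns to a single edge is arbitrary, so these
    edges are added by hand; they touch no other edge and cannot spoil the alternation.\<close>
  define P where "P = {e\<in>S. c e \<or> e \<in> lone S}"
  have "e \<in> P \<longleftrightarrow> f \<notin> P" if ef: "e \<in> S" "f \<in> S" "e \<noteq> f" "ends N e \<inter> ends N f \<noteq> {}" for e f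
  proof -
    have "e \<notin> lone S" "f \<notin> lone S"
      using ef loneD by blast+
    moreover have "c e = (\<not> c f)"
      using c ef ends_meet_iff SE by blast
    ultimately show ?thesis
      using ef by (auto simp: P_def)
  qed
  then have "alternating S P"
    using lone_subset unfolding alternating_def P_def by blast
  then show ?thesis ..
qed

text \<open>A single-edge component has an interior end of degree one, where paths and cycles demand
  degree two. Hence single edges are disjoint from the other two kinds of component.\<close>

lemma nonlone_comp:
  assumes S: "S \<subseteq> edg N" and C: "C \<in> comps N S" and sh: "is_bpath N S C \<or> is_icycle N S C"
  shows "card C \<noteq> 1"
proof
  assume "card C = 1"
  then obtain e where e: "C = {e}"
    by (auto simp: card_1_singleton_iff)
  then have "e \<in> edg N"
    using S comps_subset[OF C] by blast
  then obtain v where v: "v \<in> ends N e" "v \<in> intv N"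
    using ends_int by blast
  then have vC: "v \<in> cverts N C"
    using e by (auto simp: cverts_def)
  have "deg N S v = 2"
    using sh vC intv_bverts_disjoint[OF v(2)] by (auto simp: is_bpath_def is_icycle_def)
  moreover have "deg N S v = card (incid N {e} v)"
    using incid_comp[OF C vC] e by (simp add: deg_def)
  moreover have "card (incid N {e} v) \<le> card {e}"
    by (rule card_mono) (auto simp: incid_def)
  ultimately show False
    by simp
qed

lemma bpath_indices:
  assumes "is_bpath N S C" "i \<in> {1..nb N}" "j \<in> {1..nb N}" "i \<noteq> j"
    "bdv N i \<in> cverts N C" "bdv N j \<in> cverts N C"
  shows "cverts N C \<inter> bverts N = {bdv N i, bdv N j}"
    "{l \<in> {1..nb N}. bdv N l \<in> cverts N C} = {i, j}"
proof -
  have "{bdv N i, bdv N j} \<subseteq> cverts N C \<inter> bverts N"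
    using assms bdv_in_bverts by blast
  moreover have "card {bdv N i, bdv N j} = 2"
    using bdv_eq_iff assms by simp
  moreover have "card (cverts N C \<inter> bverts N) = 2"
    using assms(1) by (simp add: is_bpath_def)
  moreover have "finite (cverts N C \<inter> bverts N)"
    using finite_bverts by blast
  ultimately show *: "cverts N C \<inter> bverts N = {bdv N i, bdv N j}"
    by (metis card_subset_eq)
  have "l = i \<or> l = j" if l: "l \<in> {1..nb N}" "bdv N l \<in> cverts N C" for l
    using * bdv_in_bverts[OF l(1)] l bdv_eq_iff[OF l(1)] assms(2,3) by blast
  then show "{l \<in> {1..nb N}. bdv N l \<in> cverts N C} = {i, j}"
    using assms by blast
qed

lemma bpath_ex_indices:
  assumes "is_bpath N S C" "i \<in> {1..nb N}" "bdv N i \<in> cverts N C"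
  obtains j where "j \<in> {1..nb N}" "j \<noteq> i" "bdv N j \<in> cverts N C"
proof -
  have "card (cverts N C \<inter> bverts N) = 2"
    using assms(1) by (simp add: is_bpath_def)
  then obtain x where "x \<in> cverts N C \<inter> bverts N" "x \<noteq> bdv N i"
    by (auto simp: card_2_iff)
  then obtain j where "j \<in> {1..nb N}" "bdv N j \<in> cverts N C" "bdv N j \<noteq> bdv N i"
    unfolding bverts_def by blast
  then show thesis
    using that[of j] by blast
qed

lemma bedge_in_comp:
  assumes "S \<subseteq> edg N" "C \<in> comps N S" "i \<in> {1..nb N}"
  shows "bdv N i \<in> cverts N C \<longleftrightarrow> bedge i \<in> C"
proof
  assume "bdv N i \<in> cverts N C"
  then obtain e where "e \<in> C" "bdv N i \<in> ends N e"
    by (auto simp: cverts_def)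
  then show "bedge i \<in> C"
    using bedge_eq[OF assms(3), of e] comps_subset[OF assms(2)] assms(1) by blast
qed (use bedge(2)[OF assms(3)] in \<open>auto simp: cverts_def\<close>)

text \<open>Give an edge the sign \<open>1\<close> or \<open>-1\<close> according to whether it lies in
\<open>P\<close>, and a vertex the sign of its colour. Every edge has one end of each colour and the two edges
at an interior vertex of a path have opposite signs, so only the two end edges contribute to the signed sum
over all incidences, which is zero.\<close>
lemma bpath_ends_separated:
  assumes S: "locTL S" and P: "alternating S P" and C: "C \<in> comps N S" "is_bpath N S C"
    and i: "i \<in> {1..nb N}" "bdv N i \<in> cverts N C" and j: "j \<in> {1..nb N}" "bdv N j \<in> cverts N C"
    and "i \<noteq> j"
  shows "i \<in> Ilab N P \<longleftrightarrow> j \<notin> Ilab N P"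
proof -
  have SE: "S \<subseteq> edg N"
    using S by (simp add: locTL_def)
  have CE: "C \<subseteq> edg N" and PE: "P \<subseteq> edg N"
    using comps_subset[OF C(1)] alternatingD(2)[OF P] SE by blast+
  have fin: "finite C" "finite (cverts N C)"
    using finite_comp[OF SE C(1)] finite_cverts by blast+
  define \<epsilon> :: "'e \<Rightarrow> int" where "\<epsilon> e = (if e \<in> P then 1 else - 1)" for e
  define sg :: "'v \<Rightarrow> int" where "sg x = (if blk N x then 1 else - 1)" for x
  define \<delta> where "\<delta> x = (\<Sum>e\<in>incid N C x. sg x * \<epsilon> e)" for x
  have "(\<Sum>x\<in>cverts N C. \<delta> x) = (\<Sum>e\<in>C. \<Sum>x\<in>ends N e. sg x * \<epsilon> e)"
    unfolding \<delta>_def by (rule sum_incid_swap[OF fin(1)])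
  also have "\<dots> = 0"
  proof (rule sum.neutral, rule ballI)
    fix e assume "e \<in> C"
    then have "blk N (bend N e)" "\<not> blk N (wend N e)"
      using edge_ends CE by blast+
    moreover from this have "bend N e \<noteq> wend N e"
      by auto
    ultimately show "(\<Sum>x\<in>ends N e. sg x * \<epsilon> e) = 0"
      by (simp add: ends_def sg_def)
  qed
  finally have 0: "(\<Sum>x\<in>cverts N C. \<delta> x) = 0" .
  have int: "\<delta> x = 0" if x: "x \<in> cverts N C" "x \<notin> bverts N" for x
  proof -
    have "card (incid N C x) = 2"
      using C(2) x incid_comp[OF C(1) x(1)] by (auto simp: is_bpath_def deg_def)
    then obtain e f where ef: "incid N C x = {e, f}" "e \<noteq> f"
      by (auto simp: card_2_iff)
    then have "e \<in> incid N C x" "f \<in> incid N C x"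
      by auto
    then have "e \<in> S" "f \<in> S" "x \<in> ends N e" "x \<in> ends N f"
      using comps_subset[OF C(1)] by (auto simp: incid_def)
    then have "e \<in> P \<longleftrightarrow> f \<notin> P"
      using alternatingD(3)[OF P] ef(2) by blast
    then show ?thesis
      using ef by (auto simp: \<delta>_def \<epsilon>_def)
  qed
  \<comment> \<open>\<open>Ilab\<close> consists exactly of the labels at which vertex sign and edge
    sign agree: black and covered, or white and not covered.\<close>
  have bd: "\<delta> (bdv N l) = (if l \<in> Ilab N P then 1 else - 1)"
    if l: "l \<in> {1..nb N}" "bdv N l \<in> cverts N C" for l
  proof -
    have "incid N C (bdv N l) = {bedge l}"
      using incid_bdv[OF l(1) CE] bedge_in_comp[OF SE C(1) l(1)] l(2) by auto
    then show ?thesis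
      using Ilab_iff[OF PE, of l] l by (auto simp: \<delta>_def \<epsilon>_def sg_def)
  qed
  have B: "cverts N C \<inter> bverts N = {bdv N i, bdv N j}"
    using bpath_indices(1)[OF C(2)] i j \<open>i \<noteq> j\<close> by blast
  have "(\<Sum>x\<in>cverts N C. \<delta> x) = (\<Sum>x\<in>{bdv N i, bdv N j}. \<delta> x)"
    by (rule sum.mono_neutral_right[OF fin(2)]) (use B int in auto)
  also have "\<dots> = \<delta> (bdv N i) + \<delta> (bdv N j)"
    using bdv_eq_iff i j \<open>i \<noteq> j\<close> by simp
  finally show ?thesis
    using 0 bd i j by (simp split: if_splits)
qed

subsection \<open>Counting the pairs with a given union\<close>

text \<open>A component that reaches the boundary is not an interior cycle, so unless it is a single
  edge it is a path.\<close>

lemma Union_tau_of: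
  assumes S: "locTL S"
  shows "\<Union> (tau_of N S) = {i\<in>{1..nb N}. bedge i \<in> S - lone S}" (is "?L = ?R")
proof
  have SE: "S \<subseteq> edg N"
    using S by (simp add: locTL_def)
  show "?L \<subseteq> ?R"
  proof
    fix i assume "i \<in> ?L"
    then obtain C where C: "C \<in> comps N S" "is_bpath N S C" and i: "i \<in> {1..nb N}" "bdv N i \<in> cverts N C"
      unfolding tau_of_def by blast
    then have "bedge i \<in> C"
      using bedge_in_comp[OF SE] by blast
    moreover have "card C \<noteq> 1"
      using nonlone_comp[OF SE C(1)] C(2) by blast
    ultimately have "bedge i \<in> S" "bedge i \<notin> lone S"
      using comps_subset[OF C(1)] card_1_comp_iff[OF C(1)] by blast+
    with i show "i \<in> ?R"
      by blast
  qed
  show "?R \<subseteq> ?L"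
  proof
    fix i assume "i \<in> ?R"
    then have i: "i \<in> {1..nb N}" "bedge i \<in> S" "bedge i \<notin> lone S"
      by blast+
    then obtain C where C: "C \<in> comps N S" "bedge i \<in> C"
      using comps_cover by blast
    have iC: "bdv N i \<in> cverts N C"
      using bedge_in_comp[OF SE C(1) i(1)] C(2) by blast
    have "card C \<noteq> 1"
      using card_1_comp_iff[OF C] i(3) by blast
    moreover have "cverts N C \<inter> bverts N \<noteq> {}"
      using iC bdv_in_bverts[OF i(1)] by blast
    ultimately have b: "is_bpath N S C"
      using comp_shape[OF S C(1)] by blast
    obtain j where j: "j \<in> {1..nb N}" "j \<noteq> i" "bdv N j \<in> cverts N C"
      using bpath_ex_indices[OF b i(1) iC] .
    then have "{i, j} \<in> tau_of N S"
      unfolding tau_of_def using C b i(1) iC by blast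
    then show "i \<in> ?L"
      by blast
  qed
qed

lemma T_of_iff:
  assumes S: "S \<subseteq> edg N" and i: "i \<in> {1..nb N}"
  shows "i \<in> T_of N S \<longleftrightarrow> (if blk N (bdv N i) then bedge i \<in> lone S else bedge i \<notin> S)"
proof -
  have 1: "(\<exists>C\<in>comps N S. card C = 1 \<and> bdv N i \<in> cverts N C) \<longleftrightarrow> bedge i \<in> lone S"
  proof
    assume "\<exists>C\<in>comps N S. card C = 1 \<and> bdv N i \<in> cverts N C"
    then obtain C where C: "C \<in> comps N S" "card C = 1" "bdv N i \<in> cverts N C"
      by blast
    then show "bedge i \<in> lone S"
      using bedge_in_comp[OF S C(1) i] card_1_comp_iff[OF C(1)] by blast
  next
    assume l: "bedge i \<in> lone S"
    then obtain C where C: "C \<in> comps N S" "bedge i \<in> C"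
      using comps_cover lone_subset by blast
    then have "card C = 1" "bdv N i \<in> cverts N C"
      using bedge_in_comp[OF S C(1) i] card_1_comp_iff[OF C] l by blast+
    with C(1) show "\<exists>C\<in>comps N S. card C = 1 \<and> bdv N i \<in> cverts N C"
      by blast
  qed
  have 2: "incid N S (bdv N i) = {} \<longleftrightarrow> bedge i \<notin> S"
    using incid_bdv[OF i S] by simp
  show ?thesis
    unfolding T_of_def mem_Collect_eq Un_iff 1 2 using i by simp
qed

lemma T_of_subset: "T_of N S \<subseteq> {1..nb N}"
  by (auto simp: T_of_def)

lemma Ilab_subset: "Ilab N P \<subseteq> {1..nb N}"
  by (auto simp: Ilab_def)

text \<open>Three cases for \<open>bedge i\<close>: absent from \<open>S\<close>, a single edge, or
  neither. In the two former cases both configurations give the same label, determined by the colour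
  and recorded in \<open>T_of\<close>; in the last case exactly one contains the edge and the labels
  differ.\<close>

lemma Ilab_partner:
  assumes S: "locTL S" and P: "alternating S P"
  shows "Ilab N P \<inter> Ilab N (partner S P) = T_of N S"
    "i \<in> \<Union> (tau_of N S) \<longleftrightarrow> i \<in> {1..nb N} \<and> (i \<in> Ilab N P \<longleftrightarrow> i \<notin> Ilab N (partner S P))"
proof -
  have SE: "S \<subseteq> edg N"
    using S by (simp add: locTL_def)
  have PE: "P \<subseteq> edg N" "partner S P \<subseteq> edg N"
    using SE partner_Un[OF P] by blast+
  have *: "e \<in> partner S P \<longleftrightarrow> e \<in> S \<and> (e \<in> lone S \<or> e \<notin> P)" "e \<in> lone S \<Longrightarrow> e \<in> P" "e \<in> P \<Longrightarrow> e \<in> S" for e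
    using alternatingD(1,2)[OF P] lone_subset[of S] unfolding partner_def by blast+
  have "i \<in> T_of N S \<longleftrightarrow> i \<in> Ilab N P \<and> i \<in> Ilab N (partner S P)" for i
  proof (cases "i \<in> {1..nb N}")
    case True
    then show ?thesis
      unfolding Ilab_iff[OF PE(1)] Ilab_iff[OF PE(2)] T_of_iff[OF SE True]
      using *[of "bedge i"] by auto
  next
    case False
    then show ?thesis
      using T_of_subset Ilab_subset by blast
  qed
  then show "Ilab N P \<inter> Ilab N (partner S P) = T_of N S"
    by blast
  show "i \<in> \<Union> (tau_of N S) \<longleftrightarrow> i \<in> {1..nb N} \<and> (i \<in> Ilab N P \<longleftrightarrow> i \<notin> Ilab N (partner S P))"
    unfolding Union_tau_of[OF S] Ilab_iff[OF PE(1)] Ilab_iff[OF PE(2)]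
    using *[of "bedge i"] by auto
qed

lemma tau_ofE:
  assumes "p \<in> tau_of N S"
  obtains C i j where "C \<in> comps N S" "is_bpath N S C" "i \<in> {1..nb N}" "j \<in> {1..nb N}" "i \<noteq> j"
    "bdv N i \<in> cverts N C" "bdv N j \<in> cverts N C" "p = {i, j}"
  using assms unfolding tau_of_def by blast

lemma compatible_of_dimers:
  assumes S: "locTL S" and P: "alternating S P"
  shows "compatible (Ilab N P) (Ilab N (partner S P)) (tau_of N S) (T_of N S)"
proof -
  let ?I = "Ilab N P" and ?J = "Ilab N (partner S P)"
  have U: "\<Union> (tau_of N S) = (?I - ?J) \<union> (?J - ?I)"
    using Ilab_partner(2)[OF S P] Ilab_subset by blast
  have "\<exists>a\<in>?I - ?J. \<exists>b\<in>?J - ?I. p = {a, b}" if p: "p \<in> tau_of N S" for p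
  proof -
    obtain C i j where C: "C \<in> comps N S" "is_bpath N S C"
      and ij: "i \<in> {1..nb N}" "bdv N i \<in> cverts N C" "j \<in> {1..nb N}" "bdv N j \<in> cverts N C" "i \<noteq> j" "p = {i, j}"
      using tau_ofE[OF p] by metis
    have "i \<in> ?I \<longleftrightarrow> j \<notin> ?I"
      using bpath_ends_separated[OF S P C ij(1-5)] .
    moreover have "i \<in> (?I - ?J) \<union> (?J - ?I)" "j \<in> (?I - ?J) \<union> (?J - ?I)"
      using U p ij(6) by blast+
    ultimately have "i \<in> ?I - ?J \<and> j \<in> ?J - ?I \<or> j \<in> ?I - ?J \<and> i \<in> ?J - ?I"
      by blast
    moreover have "p = {j, i}"
      using ij(6) by (simp add: insert_commute)
    ultimately show ?thesis
      using ij(6) by blast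
  qed
  with U Ilab_partner(1)[OF S P] show ?thesis
    unfolding compatible_def by blast
qed

lemma tau_of_disjoint:
  assumes "p \<in> tau_of N S" "q \<in> tau_of N S" "p \<noteq> q"
  shows "p \<inter> q = {}"
proof (rule ccontr)
  assume "p \<inter> q \<noteq> {}"
  then obtain l where l: "l \<in> p" "l \<in> q"
    by blast
  obtain C i j where C: "C \<in> comps N S" "is_bpath N S C"
    and p: "i \<in> {1..nb N}" "j \<in> {1..nb N}" "i \<noteq> j" "bdv N i \<in> cverts N C" "bdv N j \<in> cverts N C" "p = {i, j}"
    using tau_ofE[OF assms(1)] by metis
  obtain D i' j' where D: "D \<in> comps N S" "is_bpath N S D"
    and q: "i' \<in> {1..nb N}" "j' \<in> {1..nb N}" "i' \<noteq> j'" "bdv N i' \<in> cverts N D" "bdv N j' \<in> cverts N D" "q = {i', j'}"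
    using tau_ofE[OF assms(2)] by metis
  have "bdv N l \<in> cverts N C \<inter> cverts N D"
    using l p q by blast
  then have "C = D"
    using cverts_disjoint[OF C(1) D(1)] by blast
  then have "p = q"
    using bpath_indices(2)[OF C(2) p(1-5)] bpath_indices(2)[OF D(2) q(1-5)] p(6) q(6) by simp
  with assms(3) show False
    by simp
qed

section \<open>Flipping a colouring on whole components\<close>

lemma in_Union_comps_iff:
  assumes "K \<subseteq> comps N S" "C \<in> comps N S" "e \<in> C"
  shows "e \<in> \<Union> K \<longleftrightarrow> C \<in> K"
  using comps_unique[OF assms(2) _ assms(3)] assms by blast

text \<open>Touching edges lie in the same component, so both are flipped or neither is. Single
  edges are excluded because they must stay in \<open>P\<close>.\<close>

lemma alternating_flip:
  assumes P: "alternating S P" and K: "K \<subseteq> {C\<in>comps N S. card C \<noteq> 1}"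
  shows "alternating S (sym_diff P (\<Union>K))"
proof -
  have Kc: "K \<subseteq> comps N S"
    using K by blast
  have KS: "\<Union>K \<subseteq> S"
    using Kc comps_subset by blast
  have "e \<notin> \<Union>K" if "e \<in> lone S" for e
    using K card_1_comp_iff that by blast
  then have "lone S \<subseteq> sym_diff P (\<Union>K)"
    using alternatingD(1)[OF P] by blast
  moreover have "sym_diff P (\<Union>K) \<subseteq> S"
    using alternatingD(2)[OF P] KS by blast
  moreover have "e \<in> sym_diff P (\<Union>K) \<longleftrightarrow> f \<notin> sym_diff P (\<Union>K)"
    if ef: "e \<in> S" "f \<in> S" "e \<noteq> f" "ends N e \<inter> ends N f \<noteq> {}" for e f
  proof -
    obtain x where x: "x \<in> ends N e" "x \<in> ends N f"
      using ef(4) by blast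
    obtain C where C: "C \<in> comps N S" "e \<in> C"
      using comps_cover ef(1) by blast
    have "f \<in> C"
      using comps_closed[OF C ef(2) x] .
    then have "e \<in> \<Union>K \<longleftrightarrow> f \<in> \<Union>K"
      using in_Union_comps_iff[OF Kc C(1)] C(2) by simp
    moreover have "e \<in> P \<longleftrightarrow> f \<notin> P"
      using alternatingD(3)[OF P ef(1-3) x] .
    ultimately show ?thesis
      by blast
  qed
  ultimately show ?thesis
    unfolding alternating_def by simp
qed

text \<open>The set where two alternating sets differ is closed under adjacency, hence a union of
  components. With \<open>alternating_flip\<close> this makes the alternating sets a torsor under
  the subsets of the components that are not single edges.\<close>

lemma alternating_differ:
  assumes P: "alternating S P" and Q: "alternating S Q"
  obtains K where "K \<subseteq> {C\<in>comps N S. card C \<noteq> 1}" "Q = sym_diff P (\<Union>K)"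
proof -
  define D where "D = sym_diff P Q"
  define K where "K = {C\<in>comps N S. C \<inter> D \<noteq> {}}"
  have sub: "C \<subseteq> D" if C: "C \<in> K" for C
  proof
    fix h assume "h \<in> C"
    obtain e where e: "e \<in> C" "e \<in> D" and Cc: "C \<in> comps N S"
      using C unfolding K_def by blast
    show "h \<in> D"
      using Cc e(1) \<open>h \<in> C\<close>
    proof (induction rule: comps_induct[where Pr = "\<lambda>h. h \<in> D"])
      case (step f g x)
      have fg: "f \<in> S" "g \<in> S"
        using step comps_subset[OF Cc] by blast+
      show ?case
      proof (cases "f = g")
        case False
        then have "f \<in> P \<longleftrightarrow> g \<notin> P" "f \<in> Q \<longleftrightarrow> g \<notin> Q"
          using alternatingD(3)[OF P fg] alternatingD(3)[OF Q fg] step by blast+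
        with step show ?thesis
          unfolding D_def by blast
      qed (use step in simp)
    qed (use e in simp)
  qed
  have "D \<subseteq> S"
    using alternatingD(2)[OF P] alternatingD(2)[OF Q] unfolding D_def by blast
  then have "D \<subseteq> \<Union>K"
    using Union_comps[of S] unfolding K_def by blast
  with sub have "D = \<Union>K"
    by blast
  then have "Q = sym_diff P (\<Union>K)"
    unfolding D_def by blast
  moreover have "card C \<noteq> 1" if C: "C \<in> K" for C
  proof -
    obtain e where e: "e \<in> C" "e \<in> D" and Cc: "C \<in> comps N S"
      using C unfolding K_def by blast
    have "e \<notin> lone S"
      using e(2) alternatingD(1)[OF P] alternatingD(1)[OF Q] unfolding D_def by blast
    then show ?thesis
      using card_1_comp_iff[OF Cc e(1)] by blast
  qed
  ultimately show thesis
    using that[of K] unfolding K_def by blast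
qed

lemma Ilab_flip:
  assumes "P \<subseteq> edg N" "X \<subseteq> edg N" "i \<in> {1..nb N}"
  shows "i \<in> Ilab N (sym_diff P X) \<longleftrightarrow> (i \<in> Ilab N P \<longleftrightarrow> bedge i \<notin> X)"
proof -
  have "sym_diff P X \<subseteq> edg N"
    using assms by blast
  then show ?thesis
    unfolding Ilab_iff[OF assms(1)] Ilab_iff[OF \<open>sym_diff P X \<subseteq> edg N\<close>] using assms(3) by blast
qed

definition icycles :: "'e set \<Rightarrow> 'e set set" where
  "icycles S = {C\<in>comps N S. is_icycle N S C}"

lemma icycle_no_bedge:
  assumes "S \<subseteq> edg N" "i \<in> {1..nb N}"
  shows "bedge i \<notin> \<Union>(icycles S)"
proof
  assume "bedge i \<in> \<Union>(icycles S)"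
  then obtain C where C: "C \<in> comps N S" "is_icycle N S C" "bedge i \<in> C"
    unfolding icycles_def by blast
  then have "bdv N i \<in> cverts N C"
    using bedge_in_comp[OF assms(1) C(1) assms(2)] by blast
  then have "bdv N i \<in> intv N"
    using C(2) by (auto simp: is_icycle_def)
  then show False
    using intv_bverts_disjoint bdv_in_bverts[OF assms(2)] by blast
qed

lemma icycles_nonlone:
  "S \<subseteq> edg N \<Longrightarrow> icycles S \<subseteq> {C\<in>comps N S. card C \<noteq> 1}"
  using nonlone_comp unfolding icycles_def by blast

text \<open>Starting from any alternating \<open>P\<close>, the paths whose end labels disagree with
  \<open>I\<close> are flipped. One flip corrects both ends of a path at once:
  \<open>Ilab N P\<close> separates them by \<open>bpath_ends_separated\<close>, and
  \<open>I\<close> separates them by compatibility.\<close>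

lemma ex_alternating_with_Ilab:
  assumes S: "locTL S" and comp: "compatible I J (tau_of N S) (T_of N S)"
    and I: "I \<subseteq> {1..nb N}"
  shows "\<exists>P. alternating S P \<and> Ilab N P = I"
proof -
  have SE: "S \<subseteq> edg N"
    using S by (simp add: locTL_def)
  obtain P where P: "alternating S P"
    using ex_alternating[OF S] by blast
  have PE: "P \<subseteq> edg N"
    using alternatingD(2)[OF P] SE by blast
  define K where "K = {C\<in>comps N S. is_bpath N S C \<and>
    (\<exists>i\<in>{1..nb N}. bdv N i \<in> cverts N C \<and> (i \<in> I \<longleftrightarrow> i \<notin> Ilab N P))}"
  have K: "K \<subseteq> {C\<in>comps N S. card C \<noteq> 1}"
    using nonlone_comp[OF SE] unfolding K_def by blast
  then have Kc: "K \<subseteq> comps N S"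
    by blast
  have KE: "\<Union>K \<subseteq> edg N"
    using Kc comps_subset SE by blast
  have "i \<in> Ilab N (sym_diff P (\<Union>K)) \<longleftrightarrow> i \<in> I" if i: "i \<in> {1..nb N}" for i
  proof (cases "i \<in> \<Union> (tau_of N S)")
    case True
    then obtain p where p: "p \<in> tau_of N S" "i \<in> p"
      by blast
    obtain C a b where C: "C \<in> comps N S" "is_bpath N S C"
      and ab: "a \<in> {1..nb N}" "bdv N a \<in> cverts N C" "b \<in> {1..nb N}" "bdv N b \<in> cverts N C" "a \<noteq> b" "p = {a, b}"
      using tau_ofE[OF p(1)] by metis
    have sepP: "a \<in> Ilab N P \<longleftrightarrow> b \<notin> Ilab N P"
      using bpath_ends_separated[OF S P C ab(1-5)] .
    have "\<exists>a\<in>I - J. \<exists>b\<in>J - I. p = {a, b}"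
      using comp p(1) unfolding compatible_def by blast
    then have sepI: "a \<in> I \<longleftrightarrow> b \<notin> I"
      using ab(5,6) by (auto simp: doubleton_eq_iff)
    have idx: "{l \<in> {1..nb N}. bdv N l \<in> cverts N C} = {a, b}"
      using bpath_indices(2)[OF C(2)] ab by blast
    have "C \<in> K \<longleftrightarrow> (\<exists>l\<in>{a, b}. l \<in> I \<longleftrightarrow> l \<notin> Ilab N P)"
      using C unfolding K_def idx[symmetric] by blast
    also have "\<dots> \<longleftrightarrow> (i \<in> I \<longleftrightarrow> i \<notin> Ilab N P)"
      using sepP sepI p(2) ab(6) by auto
    finally have CK: "C \<in> K \<longleftrightarrow> (i \<in> I \<longleftrightarrow> i \<notin> Ilab N P)" .
    have "bedge i \<in> C"
      using bedge_in_comp[OF SE C(1) i] p(2) ab by blast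
    then have "bedge i \<in> \<Union>K \<longleftrightarrow> C \<in> K"
      using in_Union_comps_iff[OF Kc C(1)] by blast
    then show ?thesis
      unfolding Ilab_flip[OF PE KE i] CK by blast
  next
    case False
    have "bedge i \<notin> \<Union>K"
    proof
      assume "bedge i \<in> \<Union>K"
      then obtain C where C: "C \<in> comps N S" "bedge i \<in> C" "C \<in> K"
        using Kc by blast
      then have "card C \<noteq> 1"
        using K by blast
      then have "bedge i \<in> S - lone S"
        using C card_1_comp_iff[OF C(1,2)] comps_subset[OF C(1)] by blast
      then show False
        using False Union_tau_of[OF S] i by blast
    qed
    \<comment> \<open>Off the paths there is no freedom: both \<open>Ilab N P\<close> and
      \<open>I\<close> must coincide with \<open>T_of N S\<close> there.\<close>
    moreover have "i \<in> Ilab N P \<longleftrightarrow> i \<in> T_of N S"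
      using Ilab_partner[OF S P] False i by blast
    moreover have "i \<in> I \<longleftrightarrow> i \<in> T_of N S"
      using comp False unfolding compatible_def by blast
    ultimately show ?thesis
      unfolding Ilab_flip[OF PE KE i] by blast
  qed
  then have "Ilab N (sym_diff P (\<Union>K)) = I"
    using I Ilab_subset by blast
  then show ?thesis
    using alternating_flip[OF P K] by blast
qed

text \<open>Flipping a path would change the labels at its ends, while flipping a cycle changes no
  label. With the labels prescribed, the solutions therefore correspond to the subsets of
  \<open>icycles S\<close>.\<close>

lemma card_alternating_Ilab:
  assumes S: "locTL S" and comp: "compatible I J (tau_of N S) (T_of N S)"
    and I: "I \<subseteq> {1..nb N}"
  shows "card {P. alternating S P \<and> Ilab N P = I} = 2 ^ card (icycles S)"
proof -
  have SE: "S \<subseteq> edg N"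
    using S by (simp add: locTL_def)
  obtain P where P: "alternating S P" "Ilab N P = I"
    using ex_alternating_with_Ilab[OF assms] by blast
  have PE: "P \<subseteq> edg N"
    using alternatingD(2)[OF P(1)] SE by blast
  have IE: "\<Union>K \<subseteq> edg N" if "K \<subseteq> comps N S" for K
    using that comps_subset SE by blast
  have ic: "icycles S \<subseteq> comps N S"
    unfolding icycles_def by blast
  let ?\<phi> = "\<lambda>K. sym_diff P (\<Union>K)"
  have "bij_betw ?\<phi> (Pow (icycles S)) {P. alternating S P \<and> Ilab N P = I}"
  proof (rule bij_betw_imageI)
    show "inj_on ?\<phi> (Pow (icycles S))"
    proof (rule inj_onI)
      fix K L assume KL: "K \<in> Pow (icycles S)" "L \<in> Pow (icycles S)" "?\<phi> K = ?\<phi> L"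
      then have eq: "\<Union>K = \<Union>L"
        by blast
      have "C \<in> K \<longleftrightarrow> C \<in> L" if C: "C \<in> comps N S" for C
      proof -
        obtain e where e: "e \<in> C"
          using comps_nonempty[OF C] by blast
        have "K \<subseteq> comps N S" "L \<subseteq> comps N S"
          using KL(1,2) ic by blast+
        from this[THEN in_Union_comps_iff, OF C e] show ?thesis
          by (simp only: eq)
      qed
      then show "K = L"
        using KL(1,2) ic by blast
    qed
    show "?\<phi> ` Pow (icycles S) = {P. alternating S P \<and> Ilab N P = I}"
    proof (intro equalityI subsetI)
      fix Q assume "Q \<in> ?\<phi> ` Pow (icycles S)"
      then obtain K where K: "K \<subseteq> icycles S" "Q = ?\<phi> K"
        by blast
      then have "alternating S Q"
        using alternating_flip[OF P(1)] icycles_nonlone[OF SE] by blast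
      moreover have "i \<in> Ilab N Q \<longleftrightarrow> i \<in> I" if i: "i \<in> {1..nb N}" for i
        using Ilab_flip[OF PE IE i, of K] icycle_no_bedge[OF SE i] K ic P(2) by blast
      then have "Ilab N Q = I"
        using Ilab_subset I by blast
      ultimately show "Q \<in> {P. alternating S P \<and> Ilab N P = I}"
        by blast
    next
      fix Q assume "Q \<in> {P. alternating S P \<and> Ilab N P = I}"
      then have Q: "alternating S Q" "Ilab N Q = I"
        by blast+
      obtain K where K: "K \<subseteq> {C\<in>comps N S. card C \<noteq> 1}" "Q = ?\<phi> K"
        using alternating_differ[OF P(1) Q(1)] .
      have "is_icycle N S C" if C: "C \<in> K" for C
      proof (rule ccontr)
        assume n: "\<not> is_icycle N S C"
        have Cc: "C \<in> comps N S" "card C \<noteq> 1"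
          using K(1) C by blast+
        obtain i where i: "i \<in> {1..nb N}" "bdv N i \<in> cverts N C"
          using comp_shape(2)[OF S Cc] n unfolding bverts_def by blast
        then have "bedge i \<in> \<Union>K"
          using bedge_in_comp[OF SE Cc(1)] C by blast
        moreover have "K \<subseteq> comps N S"
          using K(1) by blast
        ultimately have "i \<in> Ilab N Q \<longleftrightarrow> i \<notin> Ilab N P"
          using Ilab_flip[OF PE IE i(1), of K] K(2) by blast
        then show False
          using P(2) Q(2) by blast
      qed
      then show "Q \<in> ?\<phi> ` Pow (icycles S)"
        using K unfolding icycles_def by blast
    qed
  qed
  then have "card {P. alternating S P \<and> Ilab N P = I} = card (Pow (icycles S))"
    by (simp add: bij_betw_same_card)
  also have "\<dots> = 2 ^ card (icycles S)"
    using finite_comps[OF SE] ic by (simp add: card_Pow finite_subset)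
  finally show ?thesis .
qed

text \<open>Union and intersection of the pair are \<open>S\<close> and \<open>lone S\<close>, so
  the product of the two weights counts every edge of \<open>S\<close> once and the single edges
  once more. This is the component-wise product in \<open>wtTL\<close>, where single edges appear
  squared.\<close>

lemma wtTL_eq_dimer_weights:
  assumes S: "locTL S" and P: "alternating S P"
  shows "(\<Prod>e\<in>P. wgt N e) * (\<Prod>e\<in>partner S P. wgt N e) * 2 ^ card (icycles S) = wtTL N S"
proof -
  have SE: "S \<subseteq> edg N"
    using S by (simp add: locTL_def)
  have fin: "finite S"
    using SE finite_edg finite_subset by blast
  then have finP: "finite P" "finite (partner S P)"
    using partner_Un[OF P] by (metis finite_Un)+
  have "(\<Prod>C\<in>comps N S. if card C = 1 then (\<Prod>e\<in>C. (wgt N e)\<^sup>2) else (\<Prod>e\<in>C. wgt N e))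
      = (\<Prod>C\<in>comps N S. \<Prod>e\<in>C. wgt N e * (if e \<in> lone S then wgt N e else 1))"
  proof (rule prod.cong[OF refl])
    fix C assume C: "C \<in> comps N S"
    show "(if card C = 1 then (\<Prod>e\<in>C. (wgt N e)\<^sup>2) else (\<Prod>e\<in>C. wgt N e))
        = (\<Prod>e\<in>C. wgt N e * (if e \<in> lone S then wgt N e else 1))"
      using card_1_comp_iff[OF C] by (cases "card C = 1") (auto intro!: prod.cong simp: power2_eq_square)
  qed
  also have "\<dots> = (\<Prod>e\<in>\<Union>(comps N S). wgt N e * (if e \<in> lone S then wgt N e else 1))"
  proof -
    have "\<forall>C\<in>comps N S. finite C"
      using finite_comp[OF SE] by blast
    moreover have "\<forall>C\<in>comps N S. \<forall>D\<in>comps N S. C \<noteq> D \<longrightarrow> C \<inter> D = {}"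
      using comps_unique by blast
    ultimately show ?thesis
      using prod.Union_disjoint[of "comps N S" "\<lambda>e. wgt N e * (if e \<in> lone S then wgt N e else 1)"]
      by simp
  qed
  also have "\<dots> = (\<Prod>e\<in>S. wgt N e) * (\<Prod>e\<in>S. if e \<in> lone S then wgt N e else 1)"
    by (simp add: Union_comps prod.distrib)
  also have "(\<Prod>e\<in>S. if e \<in> lone S then wgt N e else 1) = (\<Prod>e\<in>lone S. wgt N e)"
    using fin lone_subset[of S] by (simp add: prod.inter_restrict[symmetric] Int_absorb1)
  also have "(\<Prod>e\<in>S. wgt N e) * (\<Prod>e\<in>lone S. wgt N e) = (\<Prod>e\<in>P. wgt N e) * (\<Prod>e\<in>partner S P. wgt N e)"
    using prod.union_inter[OF finP, of "wgt N"] partner_Un[OF P] partner_Int[OF P] by simp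
  finally show ?thesis
    unfolding wtTL_def icycles_def by (simp add: mult.commute)
qed

subsection \<open>Non-crossing pairings\<close>

definition drawing :: "'e set \<Rightarrow> complex set" where
  "drawing C = (\<Union>e\<in>C. path_image (crv N e))"

text \<open>Arcs of adjacent edges share the position of a common vertex, so connectivity passes
  from edge to edge; no simple curve through the component has to be assembled.\<close>

lemma drawing_path_component:
  assumes emb: "disk_embedded N" and S: "S \<subseteq> edg N" and C: "C \<in> comps N S"
    and x: "x \<in> cverts N C" and y: "y \<in> cverts N C"
  shows "path_component (drawing C) (pos N x) (pos N y)"
proof -
  have edge: "path_component (drawing C) (pos N u) (pos N v)"
    if e: "e \<in> C" and uv: "u \<in> ends N e" "v \<in> ends N e" for e u v
  proof -
    have "e \<in> edg N"
      using e comps_subset[OF C] S by blast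
    then have crv: "arc (crv N e)" "pathstart (crv N e) = pos N (bend N e)" "pathfinish (crv N e) = pos N (wend N e)"
      using emb by (simp_all add: disk_embedded_def)
    have "pos N z \<in> path_image (crv N e)" if "z \<in> ends N e" for z
      using that crv(2,3) pathstart_in_path_image[of "crv N e"] pathfinish_in_path_image[of "crv N e"]
      by (auto simp: ends_def)
    moreover have "path_connected (path_image (crv N e))"
      using crv(1) by (simp add: arc_imp_path path_connected_path_image)
    ultimately have "path_component (path_image (crv N e)) (pos N u) (pos N v)"
      using uv unfolding path_connected_component by blast
    then show ?thesis
      by (rule path_component_of_subset[rotated]) (use e in \<open>auto simp: drawing_def\<close>)
  qed
  obtain e f where e: "e \<in> C" "x \<in> ends N e" and f: "f \<in> C" "y \<in> ends N f"
    using x y by (auto simp: cverts_def)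
  have "\<forall>v\<in>ends N f. path_component (drawing C) (pos N x) (pos N v)"
    using C e(1) f(1)
  proof (induction rule: comps_induct[where Pr = "\<lambda>f. \<forall>v\<in>ends N f. path_component (drawing C) (pos N x) (pos N v)"])
    case base
    then show ?case
      using edge e by blast
  next
    case (step f g z)
    then have "path_component (drawing C) (pos N x) (pos N z)"
      by blast
    then show ?case
      using edge[OF step(2) step(5)] path_component_trans by blast
  qed
  then show ?thesis
    using f(2) by blast
qed

lemma drawings_disjoint:
  assumes emb: "disk_embedded N" and S: "S \<subseteq> edg N"
    and C: "C \<in> comps N S" and D: "D \<in> comps N S" and "C \<noteq> D"
  shows "drawing C \<inter> drawing D = {}"
proof -
  have "path_image (crv N e) \<inter> path_image (crv N f) = {}" if ef: "e \<in> C" "f \<in> D" for e f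
  proof -
    have "ends N e \<inter> ends N f = {}"
      using cverts_disjoint[OF C D \<open>C \<noteq> D\<close>] ef unfolding cverts_def by blast
    moreover have "e \<in> edg N" "f \<in> edg N"
      using ef comps_subset[OF C] comps_subset[OF D] S by blast+
    moreover have "e \<noteq> f"
      using comps_unique[OF C D] ef \<open>C \<noteq> D\<close> by blast
    ultimately have "path_image (crv N e) \<inter> path_image (crv N f) \<subseteq> pos N ` {}"
      using emb unfolding disk_embedded_def by metis
    then show ?thesis
      by simp
  qed
  then show ?thesis
    unfolding drawing_def by blast
qed

lemma drawing_subset:
  assumes "disk_embedded N" "C \<subseteq> edg N"
  shows "drawing C \<subseteq> cball 0 1"
proof -
  have "path_image (crv N e) \<subseteq> cball 0 1" if "e \<in> C" for e
    using assms that unfolding disk_embedded_def by blast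
  then show ?thesis
    unfolding drawing_def by blast
qed

lemma tau_of_noncrossing:
  assumes emb: "disk_embedded N" and S: "S \<subseteq> edg N"
    and ab: "{a, b} \<in> tau_of N S" and cd: "{c, d} \<in> tau_of N S"
    and order: "a < c" "c < b" "b < d"
  shows False
proof -
  obtain C i j where C: "C \<in> comps N S" "is_bpath N S C"
    and ij: "i \<in> {1..nb N}" "j \<in> {1..nb N}" "i \<noteq> j" "bdv N i \<in> cverts N C" "bdv N j \<in> cverts N C" "{a, b} = {i, j}"
    using tau_ofE[OF ab] by metis
  obtain D k l where D: "D \<in> comps N S" "is_bpath N S D"
    and kl: "k \<in> {1..nb N}" "l \<in> {1..nb N}" "k \<noteq> l" "bdv N k \<in> cverts N D" "bdv N l \<in> cverts N D" "{c, d} = {k, l}"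
    using tau_ofE[OF cd] by metis
  have C_ab: "a \<in> {1..nb N}" "b \<in> {1..nb N}" "bdv N a \<in> cverts N C" "bdv N b \<in> cverts N C"
    using ij by (auto simp: doubleton_eq_iff)
  have D_cd: "c \<in> {1..nb N}" "d \<in> {1..nb N}" "bdv N c \<in> cverts N D" "bdv N d \<in> cverts N D"
    using kl by (auto simp: doubleton_eq_iff)
  have "C \<noteq> D"
  proof
    assume "C = D"
    then have "c \<in> {l \<in> {1..nb N}. bdv N l \<in> cverts N C}"
      using D_cd by blast
    moreover have "{l \<in> {1..nb N}. bdv N l \<in> cverts N C} = {a, b}"
      by (rule bpath_indices(2)[OF C(2) C_ab(1,2) _ C_ab(3,4)]) (use order in simp)
    ultimately have "c \<in> {a, b}"
      by (simp only:)
    then show False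
      using order by simp
  qed
  \<comment> \<open>The angles \<open>- t i\<close> decrease with \<open>i\<close>, as the labels
    run clockwise; the order of the labels is thus the order of the values
    \<open>t i\<close>.\<close>
  obtain t where t: "strict_mono_on {1..nb N} t"
    "\<forall>i\<in>{1..nb N}. 0 \<le> t i \<and> t i < 2 * pi \<and> pos N (bdv N i) = cis (- t i)"
    using emb unfolding disk_embedded_def by blast
  have pos: "pos N (bdv N i) = cis (- t i)" if "i \<in> {1..nb N}" for i
    using t(2) that by blast
  have "t a < t c" "t c < t b" "t b < t d"
    using strict_mono_onD[OF t(1)] C_ab D_cd order by blast+
  moreover have "0 \<le> t a" "t d < 2 * pi"
    using t(2) C_ab D_cd by blast+
  moreover have "path_component (drawing C) (cis (- t a)) (cis (- t b))"
    using drawing_path_component[OF emb S C(1) C_ab(3,4)] pos C_ab by simp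
  moreover have "path_component (drawing D) (cis (- t c)) (cis (- t d))"
    using drawing_path_component[OF emb S D(1) D_cd(3,4)] pos D_cd by simp
  moreover have "drawing C \<subseteq> cball 0 1" "drawing D \<subseteq> cball 0 1"
    using drawing_subset[OF emb] comps_subset[OF C(1)] comps_subset[OF D(1)] S by blast+
  ultimately have "drawing C \<inter> drawing D \<noteq> {}"
    using disk_paths_meet by blast
  then show False
    using drawings_disjoint[OF emb S C(1) D(1) \<open>C \<noteq> D\<close>] by blast
qed

text \<open>The cardinality condition is the count \<open>card I + card J = 2 * k\<close>, in which
  elements of the symmetric difference occur once and those of \<open>I \<inter> J\<close> twice.
  Thus every compatible \<open>S\<close> yields a pair in the index set of the theorem.\<close>

lemma ncpairing_of_TL:
  assumes emb: "disk_embedded N" and S: "locTL S"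
    and comp: "compatible I J (tau_of N S) (T_of N S)"
    and "I \<subseteq> {1..nb N}" "J \<subseteq> {1..nb N}" "card I = k" "card J = k"
  shows "ncpairing k (nb N) (tau_of N S) (T_of N S)"
proof -
  have SE: "S \<subseteq> edg N"
    using S by (simp add: locTL_def)
  have fin: "finite I" "finite J"
    using assms finite_subset by blast+
  have U: "\<Union>(tau_of N S) = (I - J) \<union> (J - I)" and T: "T_of N S = I \<inter> J"
    using comp by (simp_all add: compatible_def)
  have "card (\<Union>(tau_of N S)) = card (I - J) + card (J - I)"
    unfolding U using fin by (intro card_Un_disjoint) auto
  moreover have "card I = card (I - J) + card (I \<inter> J)" "card J = card (J - I) + card (I \<inter> J)"
    using fin by (metis card_Int_Diff add.commute Int_commute)+
  ultimately have "card (\<Union>(tau_of N S)) + 2 * card (T_of N S) = 2 * k"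
    using T assms(6,7) by simp
  moreover have "\<forall>p\<in>tau_of N S. \<exists>a b. p = {a, b} \<and> a \<noteq> b \<and> a \<in> {1..nb N} \<and> b \<in> {1..nb N}"
    by (metis tau_ofE)
  moreover have "\<forall>p\<in>tau_of N S. \<forall>q\<in>tau_of N S. p \<noteq> q \<longrightarrow> p \<inter> q = {}"
    by (intro ballI impI tau_of_disjoint)
  moreover have "\<forall>a b c d. {a, b} \<in> tau_of N S \<and> {c, d} \<in> tau_of N S \<longrightarrow> \<not> (a < c \<and> c < b \<and> b < d)"
    by (intro allI impI notI, elim conjE) (rule tau_of_noncrossing[OF emb SE])
  moreover have "T_of N S \<subseteq> {1..nb N} - \<Union>(tau_of N S)"
    using U T assms(4) by blast
  ultimately show ?thesis
    unfolding ncpairing_def by (intro conjI)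
qed

section \<open>Regrouping the double sum over dimer configurations\<close>

lemma sum_dimer_pairs:
  assumes S: "locTL S" and comp: "compatible I J (tau_of N S) (T_of N S)"
    and I: "I \<subseteq> {1..nb N}"
  shows "(\<Sum>(P, Q)\<in>{(P, Q). is_dimer N P \<and> Ilab N P = I \<and> is_dimer N Q \<and> Ilab N Q = J \<and> P \<union> Q = S}.
      (\<Prod>e\<in>P. wgt N e) * (\<Prod>e\<in>Q. wgt N e)) = wtTL N S" (is "sum ?f ?A = _")
proof -
  define \<A> where "\<A> = {P. alternating S P \<and> Ilab N P = I}"
  \<comment> \<open>Compatibility with the same \<open>S\<close> fixes the intersection and the
    symmetric difference with \<open>I\<close>, and these two sets determine \<open>J\<close>. So
    prescribing \<open>I\<close> for \<open>P\<close> is enough.\<close>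
  have J: "Ilab N (partner S P) = J" if P: "P \<in> \<A>" for P
  proof -
    have "compatible I (Ilab N (partner S P)) (tau_of N S) (T_of N S)"
      using compatible_of_dimers[OF S, of P] P by (simp add: \<A>_def)
    with comp have "I \<inter> Ilab N (partner S P) = I \<inter> J"
      "sym_diff I (Ilab N (partner S P)) = sym_diff I J"
      by (simp_all add: compatible_def)
    then show ?thesis
      by blast
  qed
  have A: "?A = (\<lambda>P. (P, partner S P)) ` \<A>"
  proof (intro equalityI subsetI)
    fix z assume "z \<in> ?A"
    then obtain P Q where z: "z = (P, Q)" "is_dimer N P" "Ilab N P = I" "is_dimer N Q" "P \<union> Q = S"
      by blast
    then show "z \<in> (\<lambda>P. (P, partner S P)) ` \<A>"
      using dimers_alternating[OF z(2,4)] unfolding \<A>_def by blast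
  next
    fix z assume "z \<in> (\<lambda>P. (P, partner S P)) ` \<A>"
    then obtain P where P: "P \<in> \<A>" "z = (P, partner S P)"
      by blast
    then have "alternating S P" "Ilab N P = I"
      by (simp_all add: \<A>_def)
    then show "z \<in> ?A"
      using alternating_dimers[OF S] partner_Un J[OF P(1)] P(2) by simp
  qed
  have "sum ?f ?A = (\<Sum>P\<in>\<A>. (\<Prod>e\<in>P. wgt N e) * (\<Prod>e\<in>partner S P. wgt N e))"
    unfolding A by (subst sum.reindex) (auto simp: inj_on_def)
  \<comment> \<open>All pairs have the same weight, and there are as many of them as the denominator
    says.\<close>
  also have "\<dots> = (\<Sum>P\<in>\<A>. wtTL N S / 2 ^ card (icycles S))"
  proof (rule sum.cong[OF refl])
    fix P assume "P \<in> \<A>"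
    then have "alternating S P"
      by (simp add: \<A>_def)
    from wtTL_eq_dimer_weights[OF S this]
    show "(\<Prod>e\<in>P. wgt N e) * (\<Prod>e\<in>partner S P. wgt N e) = wtTL N S / 2 ^ card (icycles S)"
      by (simp add: field_simps)
  qed
  also have "\<dots> = wtTL N S"
    using card_alternating_Ilab[OF S comp I] by (simp add: \<A>_def)
  finally show ?thesis .
qed

lemma Delta_mult_Delta:
  assumes emb: "disk_embedded N"
    and I: "I \<subseteq> {1..nb N}" "card I = k" and J: "J \<subseteq> {1..nb N}" "card J = k"
  shows "Delta N I * Delta N J =
    (\<Sum>(tau, T)\<in>{(tau, T). ncpairing k (nb N) tau T \<and> compatible I J tau T}. TLimm N tau T)"
proof -
  define D where "D I = {P. is_dimer N P \<and> Ilab N P = I}" for I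
  define \<B> where "\<B> = {S. locTL S \<and> compatible I J (tau_of N S) (T_of N S)}"
  define \<R> where "\<R> = {(tau, T). ncpairing k (nb N) tau T \<and> compatible I J tau T}"
  define w where "w = (\<lambda>(P, Q). (\<Prod>e\<in>P. wgt N e) * (\<Prod>e\<in>Q. wgt N e))"
  have "D I \<subseteq> Pow (edg N)" for I
    by (auto simp: D_def is_dimer_def)
  then have finD: "finite (D I)" for I
    using finite_edg by (meson finite_Pow_iff finite_subset)
  have "\<B> \<subseteq> Pow (edg N)"
    by (auto simp: \<B>_def locTL_def)
  then have finB: "finite \<B>"
    using finite_edg by (meson finite_Pow_iff finite_subset)
  have "\<R> \<subseteq> Pow (Pow {1..nb N}) \<times> Pow {1..nb N}"
    using I(1) J(1) unfolding \<R>_def compatible_def by blast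
  then have finR: "finite \<R>"
    by (rule finite_subset) simp
  have "Delta N I * Delta N J = (\<Sum>PQ\<in>D I \<times> D J. w PQ)"
    unfolding Delta_def D_def w_def by (simp add: sum_product sum.cartesian_product)
  also have "\<dots> = (\<Sum>S\<in>\<B>. \<Sum>PQ\<in>{PQ\<in>D I \<times> D J. fst PQ \<union> snd PQ = S}. w PQ)"
  proof (rule sum.group[symmetric])
    show "(\<lambda>PQ. fst PQ \<union> snd PQ) ` (D I \<times> D J) \<subseteq> \<B>"
    proof clarify
      fix P Q assume "P \<in> D I" "Q \<in> D J"
      then have P: "is_dimer N P" "Ilab N P = I" and Q: "is_dimer N Q" "Ilab N Q = J"
        by (simp_all add: D_def)
      have "locTL (P \<union> Q)"
        using dimers_locTL[OF P(1) Q(1)] .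
      then show "fst (P, Q) \<union> snd (P, Q) \<in> \<B>"
        using compatible_of_dimers[of "P \<union> Q" P] dimers_alternating[OF P(1) Q(1)] P Q
        by (simp add: \<B>_def)
    qed
  qed (use finD finB in auto)
  also have "\<dots> = (\<Sum>S\<in>\<B>. wtTL N S)"
  proof (rule sum.cong[OF refl])
    fix S assume "S \<in> \<B>"
    then have S: "locTL S" "compatible I J (tau_of N S) (T_of N S)"
      by (simp_all add: \<B>_def)
    have "{PQ\<in>D I \<times> D J. fst PQ \<union> snd PQ = S} =
        {(P, Q). is_dimer N P \<and> Ilab N P = I \<and> is_dimer N Q \<and> Ilab N Q = J \<and> P \<union> Q = S}"
      by (auto simp: D_def)
    then show "(\<Sum>PQ\<in>{PQ\<in>D I \<times> D J. fst PQ \<union> snd PQ = S}. w PQ) = wtTL N S"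
      using sum_dimer_pairs[OF S I(1)] unfolding w_def by simp
  qed
  also have "\<dots> = (\<Sum>p\<in>\<R>. \<Sum>S\<in>{S\<in>\<B>. (tau_of N S, T_of N S) = p}. wtTL N S)"
  proof (rule sum.group[symmetric])
    show "(\<lambda>S. (tau_of N S, T_of N S)) ` \<B> \<subseteq> \<R>"
      using ncpairing_of_TL[OF emb _ _ I(1) J(1) I(2) J(2)] unfolding \<B>_def \<R>_def by blast
  qed (use finB finR in auto)
  also have "\<dots> = (\<Sum>(tau, T)\<in>\<R>. TLimm N tau T)"
  proof (rule sum.cong[OF refl], clarify)
    fix tau T assume "(tau, T) \<in> \<R>"
    then have "compatible I J tau T"
      by (simp add: \<R>_def)
    \<comment> \<open>Compatibility of \<open>S\<close> depends only on its pair
      \<open>(tau, T)\<close>, so the fibre over a compatible pair is the full summation range of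
      \<open>TLimm\<close>.\<close>
    then have "{S\<in>\<B>. (tau_of N S, T_of N S) = (tau, T)} = {S. is_TL N S \<and> tau_of N S = tau \<and> T_of N S = T}"
      unfolding \<B>_def is_TL_iff by blast
    then show "(\<Sum>S\<in>{S\<in>\<B>. (tau_of N S, T_of N S) = (tau, T)}. wtTL N S) = TLimm N tau T"
      by (simp add: TLimm_def)
  qed
  finally show ?thesis
    by (simp add: \<R>_def)
qed

end

theorem theorem3p1:
  fixes N :: "('v, 'e) pbgraph" and k n :: nat and I J :: "nat set"
  assumes "pbg_type N k n"
    and "I \<subseteq> {1..n}" and "card I = k"
    and "J \<subseteq> {1..n}" and "card J = k"
  shows "Delta N I * Delta N J =
    (\<Sum>(tau, T)\<in>{(tau, T). ncpairing k n tau T \<and> compatible I J tau T}. TLimm N tau T)"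
proof -
  have N: "is_pbgraph N" "disk_embedded N" "nb N = n"
    using assms(1) by (simp_all add: pbg_type_def)
  interpret pb_graph N
    using N(1) by unfold_locales
  show ?thesis
    using Delta_mult_Delta[OF N(2)] assms N(3) by simp
qed

end
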